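(* Let $\mathcal C_\bullet=[\mathcal C_{-1},\mathcal C_0,\mathcal C_1,\ldots,P_\bullet^*]$ be an augmented cosimplicial category satisfying assumptions (A1) and (A2). Then the classical descent category $\mathrm{Kern}(\mathrm{Sk}_{\geqslant 0}(\mathcal C_\bullet))$ and the comonad descent category $\mathcal C_{\bullet\mathsf T}$ are equivalent.
   Context: Let $\Delta_0$ be the category whose objects are the sets $[1,\ldots,n]$, $n\in\mathbb N$, and the empty set, with non-decreasing maps as morphisms; $\Delta\subset\Delta_0$ is the full subcategory of non-empty sets. A cosimplicial (resp. augmented cosimplicial) category is a covariant 2-functor (pseudofunctor) from $\Delta$ (resp. $\Delta_0$) to the 2-category of categories: it consists of categories $\mathcal C_k$, $k\ge0$ (resp. $k\ge-1$), attached to $[1,\ldots,k+1]$ (with $\mathcal C_{-1}$ attached to $\emptyset$), functors $P_f^*\colon\mathcal C_m\to\mathcal C_n$ for non-decreasing $f\colon[1,\ldots,m+1]\to[1,\ldots,n+1]$, and isomorphisms $\epsilon_{f,g}\colon P_f^*P_g^*\to P_{fg}^*$ satisfying the usual associativity (cocycle) condition for composable triples. $\mathrm{Sk}_{\geqslant0}(\mathcal C_\bullet)=[\mathcal C_0,\mathcal C_1,\ldots]$ is the cosimplicial category obtained by removing $\mathcal C_{-1}$ and the functors defined on it. Notation: $P^*\colon\mathcal C_{-1}\to\mathcal C_0$ corresponds to $\emptyset\to[1]$; $P_i^*\colon\mathcal C_0\to\mathcal C_1$ corresponds to $1\mapsto i$ ($i=1,2$); $P_{ij}^*\colon\mathcal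 C_1\to\mathcal C_2$ corresponds to $1\mapsto i,2\mapsto j$ ($1\le i<j\le3$). (A1): every functor $P_f^*\colon\mathcal C_m\to\mathcal C_n$ has a right adjoint $P_{f*}\colon\mathcal C_n\to\mathcal C_m$. (A2): call a commutative square in $\Delta_0$ formed by $f\colon[1,\ldots,r+1]\to[1,\ldots,m+1]$, $g\colon[1,\ldots,r+1]\to[1,\ldots,n+1]$, $f'\colon[1,\ldots,n+1]\to[1,\ldots,m+n-r+1]$, $g'\colon[1,\ldots,m+1]\to[1,\ldots,m+n-r+1]$, $g'f=f'g$, exact Cartesian if $f$ and $f'$ (or $g$ and $g'$) are injective and $[1,\ldots,m+n-r+1]=\mathrm{Im}\,f'\cup\mathrm{Im}\,g'$. Then for every exact Cartesian square the natural base change morphisms $P_g^*P_{f*}\to P_{f'*}P_{g'}^*$ and $P_f^*P_{g*}\to P_{g'*}P_{f'}^*$ (the first being the composition $P_g^*P_{f*}\to P_g^*P_{f*}P_{g'*}P_{g'}^*\cong P_g^*P_{g*}P_{f'*}P_{g'}^*\to P_{f'*}P_{g'}^*$ of adjunction morphisms, the second defined symmetrically) are isomorphisms. Classical descent category $\mathrm{Kern}$ of a cosimplicial category $[\mathcal C_0,\mathcal C_1,\ldots]$: objects are pairs $(F,\theta)$, $F\in\mathcal C_0$, $\theta\colon P_1^*F\to P_2^*F$ an isomorphism with $P_{23}^*\theta\circ P_{12}^*\theta=P_{13}^*\theta$ (canonical isomorphisms suppressed); morphisms $(F_1,\theta_1)\to(F_2,\theta_2)$ are $f\colon F_1\to F_2$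 in $\mathcal C_0$ with $P_2^*f\circ\theta_1=\theta_2\circ P_1^*f$. Comonad descent category $\mathcal C_{\bullet\mathsf T}$: objects are pairs $(F,h)$ with $F\in\mathcal C_0$ and $h\colon F\to P^*P_*F$ such that $\varepsilon_F\circ h=\mathrm{Id}_F$ and $P^*P_*h\circ h=P^*\eta_{P_*F}\circ h$, where $\varepsilon\colon P^*P_*\to\mathrm{Id}$, $\eta\colon\mathrm{Id}\to P_*P^*$ are the adjunction morphisms; morphisms $(F_1,h_1)\to(F_2,h_2)$ are $f\colon F_1\to F_2$ in $\mathcal C_0$ with $h_2\circ f=P^*P_*f\circ h_1$. (It is the category of comodules over the comonad $\mathsf T=(P^*P_*,\varepsilon,P^*\eta P_* )$ on $\mathcal C_0$.) *)

theory Defs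
  imports "HOL-Library.FuncSet"
begin

section \<open>Categories, functors, natural transformations\<close>

record ('o, 'm) cat =
  Obj :: "'o set"
  Arr :: "'m set"
  Dom :: "'m \<Rightarrow> 'o"
  Cod :: "'m \<Rightarrow> 'o"
  Ident :: "'o \<Rightarrow> 'm"
  Comp :: "'m \<Rightarrow> 'm \<Rightarrow> 'm"  (infixr "\<cdot>\<index>" 70)

definition Hom :: "('o, 'm) cat \<Rightarrow> 'o \<Rightarrow> 'o \<Rightarrow> 'm set" where
  "Hom C A B = {f \<in> Arr C. Dom C f = A \<and> Cod C f = B}"

locale category =
  fixes C :: "('o, 'm) cat"
  assumes dom_in: "f \<in> Arr C \<Longrightarrow> Dom C f \<in> Obj C"
    and cod_in: "f \<in> Arr C \<Longrightarrow> Cod C f \<in> Obj C"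
    and ident_in: "A \<in> Obj C \<Longrightarrow> Ident C A \<in> Hom C A A"
    and comp_in: "f \<in> Hom C A B \<Longrightarrow> g \<in> Hom C B D \<Longrightarrow> g \<cdot>\<^bsub>C\<^esub> f \<in> Hom C A D"
    and comp_ident: "f \<in> Hom C A B \<Longrightarrow> f \<cdot>\<^bsub>C\<^esub> Ident C A = f"
    and ident_comp: "f \<in> Hom C A B \<Longrightarrow> Ident C B \<cdot>\<^bsub>C\<^esub> f = f"
    and comp_assoc: "f \<in> Hom C A B \<Longrightarrow> g \<in> Hom C B D \<Longrightarrow> h \<in> Hom C D E \<Longrightarrow>
      (h \<cdot>\<^bsub>C\<^esub> g) \<cdot>\<^bsub>C\<^esub> f = h \<cdot>\<^bsub>C\<^esub> (g \<cdot>\<^bsub>C\<^esub> f)"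

definition inverse_arr :: "('o, 'm) cat \<Rightarrow> 'm \<Rightarrow> 'm \<Rightarrow> bool" where
  "inverse_arr C f g \<longleftrightarrow> f \<in> Arr C \<and> g \<in> Hom C (Cod C f) (Dom C f) \<and>
     g \<cdot>\<^bsub>C\<^esub> f = Ident C (Dom C f) \<and> f \<cdot>\<^bsub>C\<^esub> g = Ident C (Cod C f)"

definition iso_arr :: "('o, 'm) cat \<Rightarrow> 'm \<Rightarrow> bool" where
  "iso_arr C f \<longleftrightarrow> (\<exists>g. inverse_arr C f g)"

definition inv_arr :: "('o, 'm) cat \<Rightarrow> 'm \<Rightarrow> 'm" where
  "inv_arr C f = (THE g. inverse_arr C f g)"

definition full_subcat :: "('o, 'm) cat \<Rightarrow> 'o set \<Rightarrow> ('o, 'm) cat" where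
  "full_subcat C S =
     C\<lparr>Obj := Obj C \<inter> S, Arr := {f \<in> Arr C. Dom C f \<in> S \<and> Cod C f \<in> S}\<rparr>"

record ('o1, 'm1, 'o2, 'm2) ftor =
  omap :: "'o1 \<Rightarrow> 'o2"
  amap :: "'m1 \<Rightarrow> 'm2"

definition ftor_id :: "('o, 'm, 'o, 'm) ftor" where
  "ftor_id = \<lparr>omap = \<lambda>A. A, amap = \<lambda>f. f\<rparr>"

definition ftor_comp ::
  "('o2, 'm2, 'o3, 'm3) ftor \<Rightarrow> ('o1, 'm1, 'o2, 'm2) ftor \<Rightarrow> ('o1, 'm1, 'o3, 'm3) ftor"
  (infixr "\<circ>\<^sub>F" 75) where
  "G \<circ>\<^sub>F F = \<lparr>omap = \<lambda>A. omap G (omap F A), amap = \<lambda>f. amap G (amap F f)\<rparr>"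

locale is_ftor =
  C: category C + D: category D
  for C :: "('o1, 'm1) cat" and D :: "('o2, 'm2) cat" +
  fixes F :: "('o1, 'm1, 'o2, 'm2) ftor"
  assumes omap_in: "A \<in> Obj C \<Longrightarrow> omap F A \<in> Obj D"
    and amap_in: "f \<in> Hom C A B \<Longrightarrow> amap F f \<in> Hom D (omap F A) (omap F B)"
    and amap_ident: "A \<in> Obj C \<Longrightarrow> amap F (Ident C A) = Ident D (omap F A)"
    and amap_comp: "f \<in> Hom C A B \<Longrightarrow> g \<in> Hom C B E \<Longrightarrow>
      amap F (g \<cdot>\<^bsub>C\<^esub> f) = amap F g \<cdot>\<^bsub>D\<^esub> amap F f"

locale nat_trans =
  F: is_ftor C D F + G: is_ftor C D G
  for C :: "('o1, 'm1) cat" and D :: "('o2, 'm2) cat"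
    and F G :: "('o1, 'm1, 'o2, 'm2) ftor" +
  fixes \<tau> :: "'o1 \<Rightarrow> 'm2"
  assumes component_in: "A \<in> Obj C \<Longrightarrow> \<tau> A \<in> Hom D (omap F A) (omap G A)"
    and natural: "f \<in> Hom C A B \<Longrightarrow> \<tau> B \<cdot>\<^bsub>D\<^esub> amap F f = amap G f \<cdot>\<^bsub>D\<^esub> \<tau> A"

locale nat_iso = nat_trans +
  assumes component_iso: "A \<in> Obj C \<Longrightarrow> iso_arr D (\<tau> A)"

definition equivalent_categories :: "('o1, 'm1) cat \<Rightarrow> ('o2, 'm2) cat \<Rightarrow> bool" where
  "equivalent_categories C D \<longleftrightarrow>
     (\<exists>F G \<alpha> \<beta>. is_ftor C D F \<and> is_ftor D C G \<and>
        nat_iso C C ftor_id (G \<circ>\<^sub>F F) \<alpha> \<and> nat_iso D D (F \<circ>\<^sub>F G) ftor_id \<beta>)"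


section \<open>Right adjoints\<close>

record ('o1, 'm1, 'o2, 'm2) radj =
  rfun :: "('o2, 'm2, 'o1, 'm1) ftor"
  unit :: "'o1 \<Rightarrow> 'm1"
  counit :: "'o2 \<Rightarrow> 'm2"

locale is_right_adjoint =
  \<eta>: nat_trans C C ftor_id "rfun R \<circ>\<^sub>F L" "unit R" +
  \<epsilon>: nat_trans D D "L \<circ>\<^sub>F rfun R" ftor_id "counit R"
  for C :: "('o1, 'm1) cat" and D :: "('o2, 'm2) cat"
    and L :: "('o1, 'm1, 'o2, 'm2) ftor" and R :: "('o1, 'm1, 'o2, 'm2) radj" +
  assumes left_ftor: "is_ftor C D L"
    and right_ftor: "is_ftor D C (rfun R)"
    and triangle_left: "A \<in> Obj C \<Longrightarrow>
      counit R (omap L A) \<cdot>\<^bsub>D\<^esub> amap L (unit R A) = Ident D (omap L A)"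
    and triangle_right: "B \<in> Obj D \<Longrightarrow>
      amap (rfun R) (counit R B) \<cdot>\<^bsub>C\<^esub> unit R (omap (rfun R) B) = Ident C (omap (rfun R) B)"

text \<open>The right adjoint of \<open>L2 \<circ>\<^sub>F L1\<close>, where \<open>L1\<close> goes from \<open>C\<close> to some category and
  \<open>L2\<close> from there to \<open>E\<close>.\<close>

definition radj_comp ::
  "('o1, 'm1) cat \<Rightarrow> ('o3, 'm3) cat \<Rightarrow>
   ('o2, 'm2, 'o3, 'm3) ftor \<Rightarrow> ('o2, 'm2, 'o3, 'm3) radj \<Rightarrow>
   ('o1, 'm1, 'o2, 'm2) ftor \<Rightarrow> ('o1, 'm1, 'o2, 'm2) radj \<Rightarrow>
   ('o1, 'm1, 'o3, 'm3) radj" where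
  "radj_comp C E L2 R2 L1 R1 =
     \<lparr>rfun = rfun R1 \<circ>\<^sub>F rfun R2,
      unit = \<lambda>A. amap (rfun R1) (unit R2 (omap L1 A)) \<cdot>\<^bsub>C\<^esub> unit R1 A,
      counit = \<lambda>B. counit R2 B \<cdot>\<^bsub>E\<^esub> amap L2 (counit R1 (omap (rfun R2) B))\<rparr>"

text \<open>For left adjoints \<open>L\<close>, \<open>L'\<close> from \<open>C\<close> to the same category, with right adjoints given by
  \<open>R\<close>, \<open>R'\<close>, the transformation of right adjoints conjugate to \<open>\<alpha> : L' \<rightarrow> L\<close>; it goes from
  \<open>rfun R\<close> to \<open>rfun R'\<close>.\<close>

definition radj_conjugate ::
  "('o1, 'm1) cat \<Rightarrow> ('o1, 'm1, 'o2, 'm2) radj \<Rightarrow> ('o1, 'm1, 'o2, 'm2) radj \<Rightarrow>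
   ('o1 \<Rightarrow> 'm2) \<Rightarrow> 'o2 \<Rightarrow> 'm1" where
  "radj_conjugate C R R' \<alpha> B =
     amap (rfun R') (counit R B) \<cdot>\<^bsub>C\<^esub>
     amap (rfun R') (\<alpha> (omap (rfun R) B)) \<cdot>\<^bsub>C\<^esub>
     unit R' (omap (rfun R) B)"


section \<open>Pseudofunctors into categories\<close>

text \<open>All the categories of a pseudofunctor share the types of objects and of arrows, but have
  their own carriers.  The component of \<open>comp_iso X f g\<close> at \<open>A\<close> is an arrow
  \<open>P\<^sub>f (P\<^sub>g A) \<rightarrow> P\<^sub>f\<^sub>g A\<close>, that of \<open>unit_iso X i\<close> is an arrow \<open>A \<rightarrow> P\<^sub>i\<^sub>d A\<close>.\<close>

record ('i, 'j, 'o, 'm) psfun =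
  cat_at :: "'i \<Rightarrow> ('o, 'm) cat"
  pull :: "'j \<Rightarrow> ('o, 'm, 'o, 'm) ftor"
  comp_iso :: "'j \<Rightarrow> 'j \<Rightarrow> 'o \<Rightarrow> 'm"
  unit_iso :: "'i \<Rightarrow> 'o \<Rightarrow> 'm"

locale pseudofunctor =
  I: category I
  for I :: "('i, 'j) cat" +
  fixes X :: "('i, 'j, 'o, 'm) psfun"
  assumes cat_at: "i \<in> Obj I \<Longrightarrow> category (cat_at X i)"
    and pull: "f \<in> Hom I i j \<Longrightarrow> is_ftor (cat_at X i) (cat_at X j) (pull X f)"
    and comp_iso: "g \<in> Hom I i j \<Longrightarrow> f \<in> Hom I j k \<Longrightarrow>
      nat_iso (cat_at X i) (cat_at X k) (pull X f \<circ>\<^sub>F pull X g) (pull X (f \<cdot>\<^bsub>I\<^esub> g))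
        (comp_iso X f g)"
    and unit_iso: "i \<in> Obj I \<Longrightarrow>
      nat_iso (cat_at X i) (cat_at X i) ftor_id (pull X (Ident I i)) (unit_iso X i)"
    and assoc_coherence: "h \<in> Hom I i j \<Longrightarrow> g \<in> Hom I j k \<Longrightarrow> f \<in> Hom I k l \<Longrightarrow>
      A \<in> Obj (cat_at X i) \<Longrightarrow>
      comp_iso X (f \<cdot>\<^bsub>I\<^esub> g) h A \<cdot>\<^bsub>cat_at X l\<^esub> comp_iso X f g (omap (pull X h) A) =
      comp_iso X f (g \<cdot>\<^bsub>I\<^esub> h) A \<cdot>\<^bsub>cat_at X l\<^esub> amap (pull X f) (comp_iso X g h A)"
    and unit_coherence_right: "f \<in> Hom I i j \<Longrightarrow> A \<in> Obj (cat_at X i) \<Longrightarrow>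
      comp_iso X f (Ident I i) A \<cdot>\<^bsub>cat_at X j\<^esub> amap (pull X f) (unit_iso X i A) =
      Ident (cat_at X j) (omap (pull X f) A)"
    and unit_coherence_left: "f \<in> Hom I i j \<Longrightarrow> A \<in> Obj (cat_at X i) \<Longrightarrow>
      comp_iso X (Ident I j) f A \<cdot>\<^bsub>cat_at X j\<^esub> unit_iso X j (omap (pull X f) A) =
      Ident (cat_at X j) (omap (pull X f) A)"


section \<open>Augmented cosimplicial categories\<close>

text \<open>The object \<open>n\<close> of \<open>\<Delta>\<^sub>0\<close> is the set \<open>{1..n}\<close>, so the category usually written \<open>C\<^sub>k\<close> is
  \<open>cat_at X (k + 1)\<close>.  The arrows are triples (source, map, target); the map is extensional, so
  that equality of arrows is equality of maps on \<open>{1..n}\<close>.\<close>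

type_synonym darr = "nat \<times> (nat \<Rightarrow> nat) \<times> nat"

definition Delta0 :: "(nat, darr) cat" where
  "Delta0 =
     \<lparr>Obj = UNIV,
      Arr = {(m, f, n). f \<in> {1..m} \<rightarrow>\<^sub>E {1..n} \<and> mono_on {1..m} f},
      Dom = (\<lambda>(m, f, n). m),
      Cod = (\<lambda>(m, f, n). n),
      Ident = (\<lambda>n. (n, \<lambda>i\<in>{1..n}. i, n)),
      Comp = (\<lambda>(m', g, n) (m, f, n'). (m, compose {1..m} g f, n))\<rparr>"

definition Delta :: "(nat, darr) cat" where
  "Delta = full_subcat Delta0 {n. {1..n} \<noteq> {}}"

lemma category_Delta0: "category Delta0"
proof
  show "f \<in> Hom Delta0 A B \<Longrightarrow> f \<cdot>\<^bsub>Delta0\<^esub> Ident Delta0 A = f" for f A B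
    by (auto simp: Hom_def Delta0_def compose_def fun_eq_iff PiE_def extensional_def Pi_def split: if_splits)
  show "f \<in> Hom Delta0 A B \<Longrightarrow> Ident Delta0 B \<cdot>\<^bsub>Delta0\<^esub> f = f" for f A B
    by (auto simp: Hom_def Delta0_def compose_def fun_eq_iff PiE_def extensional_def Pi_def split: if_splits)
  show "f \<in> Hom Delta0 A B \<Longrightarrow> g \<in> Hom Delta0 B D \<Longrightarrow> g \<cdot>\<^bsub>Delta0\<^esub> f \<in> Hom Delta0 A D" for f g A B D
    by (auto simp: Hom_def Delta0_def compose_def PiE_def extensional_def Pi_def mono_on_def)
  show "f \<in> Hom Delta0 A B \<Longrightarrow> g \<in> Hom Delta0 B D \<Longrightarrow> h \<in> Hom Delta0 D E \<Longrightarrow>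
      (h \<cdot>\<^bsub>Delta0\<^esub> g) \<cdot>\<^bsub>Delta0\<^esub> f = h \<cdot>\<^bsub>Delta0\<^esub> (g \<cdot>\<^bsub>Delta0\<^esub> f)" for f g h A B D E
    by (auto simp: Hom_def Delta0_def compose_def fun_eq_iff PiE_def Pi_def)
qed (auto simp: Hom_def Delta0_def mono_on_def)

lemma Hom_Delta: "f \<in> Hom Delta i j \<longleftrightarrow> f \<in> Hom Delta0 i j \<and> 1 \<le> i \<and> 1 \<le> j"
  by (auto simp: Delta_def full_subcat_def Hom_def)

lemma Delta_simps: "Obj Delta = {1..}" "Comp Delta = Comp Delta0" "Ident Delta = Ident Delta0"
  by (auto simp: Delta_def full_subcat_def Delta0_def)

lemma Arr_Delta: "f \<in> Hom Delta i j \<Longrightarrow> f \<in> Arr Delta" by (auto simp: Hom_def)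

lemma category_Delta: "category Delta"
proof -
  interpret category Delta0 by (rule category_Delta0)
  show ?thesis
    apply (unfold_locales)
    subgoal by (auto simp: Delta_def full_subcat_def dom_in)
    subgoal by (auto simp: Delta_def full_subcat_def cod_in)
    subgoal using ident_in by (auto simp: Hom_Delta Delta_simps Delta0_def)
    subgoal for f A B g D using comp_in[of f A B g D] by (auto simp: Hom_Delta Delta_simps )
    subgoal for f A B using comp_ident[of f A B] by (auto simp: Hom_Delta Delta_simps )
    subgoal for f A B using ident_comp[of f A B] by (auto simp: Hom_Delta Delta_simps )
    subgoal for f A B g D h E using comp_assoc[of f A B g D h E] by (auto simp: Hom_Delta Delta_simps )
    done
qed

type_synonym ('o, 'm) cosimp = "(nat, darr, 'o, 'm) psfun"

abbreviation cosimplicial :: "('o, 'm) cosimp \<Rightarrow> bool" where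
  "cosimplicial X \<equiv> pseudofunctor Delta X"

abbreviation augmented_cosimplicial :: "('o, 'm) cosimp \<Rightarrow> bool" where
  "augmented_cosimplicial X \<equiv> pseudofunctor Delta0 X"

definition Sk0 :: "('o, 'm) cosimp \<Rightarrow> ('o, 'm) cosimp" where
  "Sk0 X =
     \<lparr>cat_at = restrict (cat_at X) (Obj Delta),
      pull = restrict (pull X) (Arr Delta),
      comp_iso = (\<lambda>f\<in>Arr Delta. \<lambda>g\<in>Arr Delta. comp_iso X f g),
      unit_iso = restrict (unit_iso X) (Obj Delta)\<rparr>"

lemma cosimplicial_Sk0:
  assumes "augmented_cosimplicial X" shows "cosimplicial (Sk0 X)"
proof -
  interpret pseudofunctor Delta0 X by fact
  interpret D: category Delta by (rule category_Delta)
  have o: "Obj Delta0 = UNIV" by (simp add: Delta0_def)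
  have c: "f \<in> Hom Delta i j \<Longrightarrow> g \<in> Hom Delta j k \<Longrightarrow> Comp Delta0 g f \<in> Arr Delta" for f g i j k
    using D.comp_in[of f i j g k] by (simp add: Delta_simps Arr_Delta)
  have d: "i \<ge> Suc 0 \<Longrightarrow> Ident Delta0 i \<in> Arr Delta" for i
    using D.ident_in[of i] by (simp add: Delta_simps Arr_Delta)
  have e: "f \<in> Hom Delta i j \<Longrightarrow> f \<in> Hom Delta0 i j \<and> f \<in> Arr Delta \<and> i \<ge> Suc 0 \<and> j \<ge> Suc 0" for f i j
    by (auto simp: Hom_Delta Arr_Delta)
  show ?thesis
    apply (rule pseudofunctor.intro[OF category_Delta pseudofunctor_axioms.intro])
    subgoal by (auto simp: Sk0_def cat_at o Delta_simps)
    subgoal by (auto simp: Sk0_def Delta_simps dest!: e intro: pull)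
    subgoal for g i j f k using c[of g i j f k] by (auto simp: Sk0_def Delta_simps dest!: e intro: comp_iso)
    subgoal for i using d[of i] by (auto simp: Sk0_def Delta_simps o intro: unit_iso)
    subgoal for h i j g k f l A using c[of g j k f l] c[of h i j g k] e[of f] e[of g] e[of h] assoc_coherence[of h i j g k f l A] by (auto simp: Sk0_def Delta_simps)
    subgoal for f i j A using d[of i] e[of f] unit_coherence_right[of f i j A] by (auto simp: Sk0_def Delta_simps)
    subgoal for f i j A using d[of j] e[of f] unit_coherence_left[of f i j A] by (auto simp: Sk0_def Delta_simps)
    done
qed

text \<open>\<open>dmap [j\<^sub>1, \<dots>, j\<^sub>m] n\<close> is the map from \<open>{1..m}\<close> to \<open>{1..n}\<close> sending each \<open>i\<close> to \<open>j\<^sub>i\<close>.\<close>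

definition dmap :: "nat list \<Rightarrow> nat \<Rightarrow> darr" where
  "dmap js n = (length js, \<lambda>i\<in>{1..length js}. js ! (i - 1), n)"


section \<open>Adjoints and base change\<close>

definition right_adjoints ::
  "('o, 'm) cosimp \<Rightarrow> (darr \<Rightarrow> ('o, 'm, 'o, 'm) radj) \<Rightarrow> bool" where
  "right_adjoints X R \<longleftrightarrow>
     (\<forall>f\<in>Arr Delta0. is_right_adjoint
        (cat_at X (Dom Delta0 f)) (cat_at X (Cod Delta0 f)) (pull X f) (R f))"

definition dfun :: "darr \<Rightarrow> nat \<Rightarrow> nat" where
  "dfun f = fst (snd f)"

text \<open>With the cardinalities \<open>a = r + 1\<close>, \<open>b = m + 1\<close>, \<open>c = n + 1\<close>, the condition
  \<open>a + d = b + c\<close> says that the fourth vertex is \<open>{1..m + n - r + 1}\<close>.\<close>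

definition exact_cartesian :: "darr \<Rightarrow> darr \<Rightarrow> darr \<Rightarrow> darr \<Rightarrow> bool" where
  "exact_cartesian f g f' g' \<longleftrightarrow>
     (\<exists>a b c d. f \<in> Hom Delta0 a b \<and> g \<in> Hom Delta0 a c \<and>
        f' \<in> Hom Delta0 c d \<and> g' \<in> Hom Delta0 b d \<and>
        a + d = b + c \<and>
        g' \<cdot>\<^bsub>Delta0\<^esub> f = f' \<cdot>\<^bsub>Delta0\<^esub> g \<and>
        (inj_on (dfun f) {1..a} \<and> inj_on (dfun f') {1..c} \<or>
         inj_on (dfun g) {1..a} \<and> inj_on (dfun g') {1..b}) \<and>
        {1..d} = dfun f' ` {1..c} \<union> dfun g' ` {1..b})"

text \<open>The isomorphism \<open>P\<^sub>f\<^sub>' P\<^sub>g \<rightarrow> P\<^sub>f\<^sub>'\<^sub>g = P\<^sub>g\<^sub>'\<^sub>f \<rightarrow> P\<^sub>g\<^sub>' P\<^sub>f\<close> attached to a commutative square.\<close>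

definition square_iso ::
  "('o, 'm) cosimp \<Rightarrow> darr \<Rightarrow> darr \<Rightarrow> darr \<Rightarrow> darr \<Rightarrow> 'o \<Rightarrow> 'm" where
  "square_iso X f g f' g' A =
     (let D = cat_at X (Cod Delta0 g')
      in inv_arr D (comp_iso X g' f A) \<cdot>\<^bsub>D\<^esub> comp_iso X f' g A)"

text \<open>The induced canonical transformation \<open>P\<^sub>f\<^sub>* P\<^sub>g\<^sub>'\<^sub>* \<rightarrow> P\<^sub>g\<^sub>* P\<^sub>f\<^sub>'\<^sub>*\<close>.\<close>

definition square_iso_adj ::
  "('o, 'm) cosimp \<Rightarrow> (darr \<Rightarrow> ('o, 'm, 'o, 'm) radj) \<Rightarrow>
   darr \<Rightarrow> darr \<Rightarrow> darr \<Rightarrow> darr \<Rightarrow> 'o \<Rightarrow> 'm" where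
  "square_iso_adj X R f g f' g' =
     (let C = cat_at X (Dom Delta0 f); D = cat_at X (Cod Delta0 g')
      in radj_conjugate C
           (radj_comp C D (pull X g') (R g') (pull X f) (R f))
           (radj_comp C D (pull X f') (R f') (pull X g) (R g))
           (square_iso X f g f' g'))"

text \<open>The composition
  \<open>P\<^sub>g P\<^sub>f\<^sub>* \<rightarrow> P\<^sub>g P\<^sub>f\<^sub>* P\<^sub>g\<^sub>'\<^sub>* P\<^sub>g\<^sub>' \<rightarrow> P\<^sub>g P\<^sub>g\<^sub>* P\<^sub>f\<^sub>'\<^sub>* P\<^sub>g\<^sub>' \<rightarrow> P\<^sub>f\<^sub>'\<^sub>* P\<^sub>g\<^sub>'\<close>.\<close>

definition base_change ::
  "('o, 'm) cosimp \<Rightarrow> (darr \<Rightarrow> ('o, 'm, 'o, 'm) radj) \<Rightarrow>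
   darr \<Rightarrow> darr \<Rightarrow> darr \<Rightarrow> darr \<Rightarrow> 'o \<Rightarrow> 'm" where
  "base_change X R f g f' g' A =
     (let D = cat_at X (Cod Delta0 g); B = omap (pull X g') A
      in counit (R g) (omap (rfun (R f')) B) \<cdot>\<^bsub>D\<^esub>
         amap (pull X g) (square_iso_adj X R f g f' g' B) \<cdot>\<^bsub>D\<^esub>
         amap (pull X g) (amap (rfun (R f)) (unit (R g') A)))"

definition base_change_iso ::
  "('o, 'm) cosimp \<Rightarrow> (darr \<Rightarrow> ('o, 'm, 'o, 'm) radj) \<Rightarrow>
   darr \<Rightarrow> darr \<Rightarrow> darr \<Rightarrow> darr \<Rightarrow> bool" where
  "base_change_iso X R f g f' g' \<longleftrightarrow>
     nat_iso (cat_at X (Cod Delta0 f)) (cat_at X (Cod Delta0 g))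
       (pull X g \<circ>\<^sub>F rfun (R f)) (rfun (R f') \<circ>\<^sub>F pull X g')
       (base_change X R f g f' g')"

definition exact_base_change ::
  "('o, 'm) cosimp \<Rightarrow> (darr \<Rightarrow> ('o, 'm, 'o, 'm) radj) \<Rightarrow> bool" where
  "exact_base_change X R \<longleftrightarrow>
     (\<forall>f g f' g'. exact_cartesian f g f' g' \<longrightarrow>
        base_change_iso X R f g f' g' \<and> base_change_iso X R g f g' f')"


section \<open>Descent categories\<close>

text \<open>The category of pairs \<open>(F, s)\<close>, where \<open>F\<close> is an object of \<open>C\<close> and \<open>s\<close> a structure on it;
  \<open>ob\<close> selects the admissible pairs and \<open>mor\<close> the compatible arrows of \<open>C\<close>.  The arrows record
  their source and target.\<close>

definition struct_cat ::
  "('o, 'm) cat \<Rightarrow> ('o \<Rightarrow> 's \<Rightarrow> bool) \<Rightarrow> ('s \<Rightarrow> 's \<Rightarrow> 'm \<Rightarrow> bool) \<Rightarrow>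
   ('o \<times> 's, ('o \<times> 's) \<times> 'm \<times> ('o \<times> 's)) cat" where
  "struct_cat C ob mor =
     \<lparr>Obj = {(F, s). F \<in> Obj C \<and> ob F s},
      Arr = {((F, s), f, (G, t)). F \<in> Obj C \<and> ob F s \<and> G \<in> Obj C \<and> ob G t \<and>
               f \<in> Hom C F G \<and> mor s t f},
      Dom = (\<lambda>(x, f, y). x),
      Cod = (\<lambda>(x, f, y). y),
      Ident = (\<lambda>x. (x, Ident C (fst x), x)),
      Comp = (\<lambda>(y', g, z) (x, f, y). (x, g \<cdot>\<^bsub>C\<^esub> f, z))\<rparr>"

text \<open>The arrow \<open>P\<^sub>u\<^sub>p F \<rightarrow> P\<^sub>u\<^sub>q F\<close> obtained from \<open>P\<^sub>u \<theta>\<close>, for \<open>\<theta> : P\<^sub>p F \<rightarrow> P\<^sub>q F\<close>.\<close>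

definition pull_along ::
  "('o, 'm) cosimp \<Rightarrow> darr \<Rightarrow> darr \<Rightarrow> darr \<Rightarrow> 'o \<Rightarrow> 'm \<Rightarrow> 'm" where
  "pull_along X u p q F \<theta> =
     (let D = cat_at X (Cod Delta u)
      in comp_iso X u q F \<cdot>\<^bsub>D\<^esub> amap (pull X u) \<theta> \<cdot>\<^bsub>D\<^esub> inv_arr D (comp_iso X u p F))"

definition Kern ::
  "('o, 'm) cosimp \<Rightarrow> ('o \<times> 'm, ('o \<times> 'm) \<times> 'm \<times> ('o \<times> 'm)) cat" where
  "Kern X =
     (let C0 = cat_at X 1; C1 = cat_at X 2; C2 = cat_at X 3;
          p1 = dmap [1] 2; p2 = dmap [2] 2;
          p12 = dmap [1, 2] 3; p13 = dmap [1, 3] 3; p23 = dmap [2, 3] 3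
      in struct_cat C0
           (\<lambda>F \<theta>. \<theta> \<in> Hom C1 (omap (pull X p1) F) (omap (pull X p2) F) \<and> iso_arr C1 \<theta> \<and>
              pull_along X p23 p1 p2 F \<theta> \<cdot>\<^bsub>C2\<^esub> pull_along X p12 p1 p2 F \<theta> =
              pull_along X p13 p1 p2 F \<theta>)
           (\<lambda>\<theta>\<^sub>1 \<theta>\<^sub>2 f.
              amap (pull X p2) f \<cdot>\<^bsub>C1\<^esub> \<theta>\<^sub>1 = \<theta>\<^sub>2 \<cdot>\<^bsub>C1\<^esub> amap (pull X p1) f))"

definition comodule_cat ::
  "('o2, 'm2) cat \<Rightarrow> ('o1, 'm1, 'o2, 'm2) ftor \<Rightarrow> ('o1, 'm1, 'o2, 'm2) radj \<Rightarrow>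
   ('o2 \<times> 'm2, ('o2 \<times> 'm2) \<times> 'm2 \<times> ('o2 \<times> 'm2)) cat" where
  "comodule_cat D L R =
     (let T = L \<circ>\<^sub>F rfun R
      in struct_cat D
           (\<lambda>F h. h \<in> Hom D F (omap T F) \<and>
              counit R F \<cdot>\<^bsub>D\<^esub> h = Ident D F \<and>
              amap T h \<cdot>\<^bsub>D\<^esub> h = amap L (unit R (omap (rfun R) F)) \<cdot>\<^bsub>D\<^esub> h)
           (\<lambda>h\<^sub>1 h\<^sub>2 f. h\<^sub>2 \<cdot>\<^bsub>D\<^esub> f = amap T f \<cdot>\<^bsub>D\<^esub> h\<^sub>1))"

definition comonad_descent ::
  "('o, 'm) cosimp \<Rightarrow> (darr \<Rightarrow> ('o, 'm, 'o, 'm) radj) \<Rightarrow>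
   ('o \<times> 'm, ('o \<times> 'm) \<times> 'm \<times> ('o \<times> 'm)) cat" where
  "comonad_descent X R =
     comodule_cat (cat_at X 1) (pull X (dmap [] 1)) (R (dmap [] 1))"

end

theory Submission
  imports Defs
begin

text \<open>A coaction \<open>h : F \<rightarrow> P\<^sup>*P\<^sub>*F\<close> is turned into the gluing map
  \<open>\<theta> : P\<^sub>1\<^sup>*F \<rightarrow> P\<^sub>1\<^sup>*P\<^sup>*P\<^sub>*F \<cong> P\<^sub>2\<^sup>*P\<^sup>*P\<^sub>*F \<rightarrow> P\<^sub>2\<^sup>*F\<close>, and base change along the square of
  \<open>\<emptyset> \<rightarrow> [1]\<close> with itself makes this a bijection between all arrows \<open>h\<close> and all arrows \<open>\<theta>\<close>.
  The cocycle condition compares two arrows \<open>P\<^sub>1\<^sup>*F \<rightarrow> P\<^sub>3\<^sup>*F\<close> in \<open>C\<^sub>2\<close> that come from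
  \<open>P\<^sup>*P\<^sub>*h \<circ> h\<close> and \<open>P\<^sup>*\<eta>P\<^sub>* \<circ> h\<close>; base change along the pushout of \<open>P\<^sub>1\<close> and \<open>P\<^sub>2\<close> shows that
  nothing is lost on the way, so the cocycle condition is coassociativity.  Maps in \<open>\<Delta>\<^sub>0\<close> being
  monotone, \<open>\<theta>\<close> cannot be inverted by swapping two points; for a comodule the inverse is instead
  the gluing map of the same \<open>h\<close> from \<open>P\<^sub>2\<^sup>*F\<close> to \<open>P\<^sub>1\<^sup>*F\<close>.\<close>

section \<open>Categories, functors and transformations\<close>

context category
begin

lemma HomI: "f \<in> Arr C \<Longrightarrow> Dom C f = A \<Longrightarrow> Cod C f = B \<Longrightarrow> f \<in> Hom C A B"
  by (simp add: Hom_def)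

text \<open>This rule and the next ones recast the axioms from \<open>Hom\<close> membership into
  equations on \<open>Dom\<close> and \<open>Cod\<close>, side conditions that rewriting can settle;
  composites are normalised to right bracketing.\<close>

lemma dom_cod_obj [simp]:
  assumes "f \<in> Arr C"
  shows "Dom C f \<in> Obj C" "Cod C f \<in> Obj C"
  using assms by (simp_all add: dom_in cod_in)

lemma ident_simps [simp]:
  assumes "A \<in> Obj C"
  shows "Ident C A \<in> Arr C" "Dom C (Ident C A) = A" "Cod C (Ident C A) = A"
  using ident_in[OF assms] by (simp_all add: Hom_def)

lemma comp_simps [simp]:
  assumes "f \<in> Arr C" "g \<in> Arr C" "Cod C f = Dom C g"
  shows "g \<cdot>\<^bsub>C\<^esub> f \<in> Arr C" "Dom C (g \<cdot>\<^bsub>C\<^esub> f) = Dom C f" "Cod C (g \<cdot>\<^bsub>C\<^esub> f) = Cod C g"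
  using comp_in[OF HomI[OF assms(1) refl assms(3)] HomI[OF assms(2) refl refl]]
  by (simp_all add: Hom_def)

lemma comp_ident_simps [simp]:
  assumes "f \<in> Arr C"
  shows "Dom C f = A \<Longrightarrow> f \<cdot>\<^bsub>C\<^esub> Ident C A = f" "Cod C f = A \<Longrightarrow> Ident C A \<cdot>\<^bsub>C\<^esub> f = f"
  using comp_ident[OF HomI[OF assms refl refl]] ident_comp[OF HomI[OF assms refl refl]] by auto

lemma comp_assoc_simp [simp]:
  assumes "f \<in> Arr C" "g \<in> Arr C" "h \<in> Arr C" "Cod C f = Dom C g" "Cod C g = Dom C h"
  shows "(h \<cdot>\<^bsub>C\<^esub> g) \<cdot>\<^bsub>C\<^esub> f = h \<cdot>\<^bsub>C\<^esub> (g \<cdot>\<^bsub>C\<^esub> f)"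
  using assms by (intro comp_assoc HomI) auto

text \<open>Once composites are bracketed to the right, a commuting square no longer occurs as a
  subterm. This form with a tail \<open>x\<close>, and the triangle version after it, apply such
  equations in the middle of a longer composite.\<close>

lemma comp_eq_extend:
  assumes "a \<cdot>\<^bsub>C\<^esub> b = c \<cdot>\<^bsub>C\<^esub> d"
    and "a \<in> Arr C" "b \<in> Arr C" "c \<in> Arr C" "d \<in> Arr C" "x \<in> Arr C"
    and "Cod C b = Dom C a" "Cod C d = Dom C c" "Cod C x = Dom C b" "Dom C d = Dom C b"
  shows "a \<cdot>\<^bsub>C\<^esub> (b \<cdot>\<^bsub>C\<^esub> x) = c \<cdot>\<^bsub>C\<^esub> (d \<cdot>\<^bsub>C\<^esub> x)"
  using assms by (simp add: comp_assoc_simp[symmetric] del: comp_assoc_simp)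

lemma comp_eq_extend1:
  assumes "a \<cdot>\<^bsub>C\<^esub> b = c"
    and "a \<in> Arr C" "b \<in> Arr C" "x \<in> Arr C" "Cod C b = Dom C a" "Cod C x = Dom C b"
  shows "a \<cdot>\<^bsub>C\<^esub> (b \<cdot>\<^bsub>C\<^esub> x) = c \<cdot>\<^bsub>C\<^esub> x"
  using assms by (simp add: comp_assoc_simp[symmetric] del: comp_assoc_simp)

lemma inverse_arr_unique:
  assumes "inverse_arr C f g" "inverse_arr C f g'"
  shows "g = g'"
proof -
  have *: "f \<in> Arr C" "g \<in> Arr C" "g' \<in> Arr C" "Dom C g = Cod C f" "Dom C g' = Cod C f"
    "Cod C g = Dom C f" "Cod C g' = Dom C f" "g \<cdot>\<^bsub>C\<^esub> f = Ident C (Dom C f)" "f \<cdot>\<^bsub>C\<^esub> g' = Ident C (Cod C f)"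
    using assms by (auto simp: inverse_arr_def Hom_def)
  have "g \<cdot>\<^bsub>C\<^esub> (f \<cdot>\<^bsub>C\<^esub> g') = (g \<cdot>\<^bsub>C\<^esub> f) \<cdot>\<^bsub>C\<^esub> g'"
    using *(1-7) by simp
  then show ?thesis
    using * by simp
qed

lemma inv_arr_eq: "inverse_arr C f g \<Longrightarrow> inv_arr C f = g"
  unfolding inv_arr_def by (blast intro: inverse_arr_unique)

lemma iso_arrI:
  assumes "f \<in> Arr C" "g \<in> Arr C" "Dom C g = Cod C f" "Cod C g = Dom C f"
    and "g \<cdot>\<^bsub>C\<^esub> f = Ident C (Dom C f)" "f \<cdot>\<^bsub>C\<^esub> g = Ident C (Cod C f)"
  shows "iso_arr C f"
  using assms by (auto simp: iso_arr_def inverse_arr_def Hom_def)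

lemma inverse_inv_arr: "iso_arr C f \<Longrightarrow> inverse_arr C f (inv_arr C f)"
  unfolding iso_arr_def using inv_arr_eq by blast

lemma iso_arr_arr: "iso_arr C f \<Longrightarrow> f \<in> Arr C"
  by (auto simp: iso_arr_def inverse_arr_def)

lemma inv_arr_simps [simp]:
  assumes "iso_arr C f"
  shows "inv_arr C f \<in> Arr C" "Dom C (inv_arr C f) = Cod C f" "Cod C (inv_arr C f) = Dom C f"
    "inv_arr C f \<cdot>\<^bsub>C\<^esub> f = Ident C (Dom C f)" "f \<cdot>\<^bsub>C\<^esub> inv_arr C f = Ident C (Cod C f)"
  using inverse_inv_arr[OF assms] by (auto simp: inverse_arr_def Hom_def)

lemma inv_arr_cancel [simp]:
  assumes "iso_arr C f" "x \<in> Arr C"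
  shows "Cod C x = Dom C f \<Longrightarrow> inv_arr C f \<cdot>\<^bsub>C\<^esub> (f \<cdot>\<^bsub>C\<^esub> x) = x"
    "Cod C x = Cod C f \<Longrightarrow> f \<cdot>\<^bsub>C\<^esub> (inv_arr C f \<cdot>\<^bsub>C\<^esub> x) = x"
  using assms iso_arr_arr[OF assms(1)]
  by (simp_all add: comp_assoc_simp[symmetric] del: comp_assoc_simp)

lemma iso_inv_arr [simp]: "iso_arr C f \<Longrightarrow> iso_arr C (inv_arr C f)"
  by (rule iso_arrI[of _ f]) (simp_all add: iso_arr_arr)

lemma iso_comp [simp]:
  assumes "iso_arr C f" "iso_arr C g" "Cod C f = Dom C g"
  shows "iso_arr C (g \<cdot>\<^bsub>C\<^esub> f)"
  by (rule iso_arrI[of _ "inv_arr C f \<cdot>\<^bsub>C\<^esub> inv_arr C g"])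
    (use assms in \<open>simp_all add: iso_arr_arr\<close>)

lemma iso_ident [simp]: "A \<in> Obj C \<Longrightarrow> iso_arr C (Ident C A)"
  by (rule iso_arrI[of _ "Ident C A"]) simp_all

lemma iso_comp_left_cancel:
  assumes "iso_arr C f" "x \<in> Arr C" "y \<in> Arr C" "Cod C x = Dom C f" "Cod C y = Dom C f"
    and "f \<cdot>\<^bsub>C\<^esub> x = f \<cdot>\<^bsub>C\<^esub> y"
  shows "x = y"
proof -
  have "inv_arr C f \<cdot>\<^bsub>C\<^esub> (f \<cdot>\<^bsub>C\<^esub> x) = inv_arr C f \<cdot>\<^bsub>C\<^esub> (f \<cdot>\<^bsub>C\<^esub> y)"
    using assms(6) by simp
  then show ?thesis
    using assms(1-5) by simp
qed

lemma iso_comp_bij: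
  assumes "iso_arr C f"
  shows "bij_betw (\<lambda>v. f \<cdot>\<^bsub>C\<^esub> v) (Hom C A (Dom C f)) (Hom C A (Cod C f))"
  by (rule bij_betw_byWitness[where f' = "\<lambda>w. inv_arr C f \<cdot>\<^bsub>C\<^esub> w"])
    (use assms iso_arr_arr[OF assms] in \<open>auto simp: Hom_def\<close>)

lemma iso_idempotent_ident:
  assumes "iso_arr C t" "t \<cdot>\<^bsub>C\<^esub> t = t" "Dom C t = Cod C t"
  shows "t = Ident C (Dom C t)"
  by (rule iso_comp_left_cancel[OF assms(1)]) (use assms iso_arr_arr[OF assms(1)] in simp_all)

end

section \<open>Functors and natural transformations\<close>

lemma ftor_comp_simps [simp]:
  "omap (G \<circ>\<^sub>F F) A = omap G (omap F A)" "amap (G \<circ>\<^sub>F F) f = amap G (amap F f)"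
  by (simp_all add: ftor_comp_def)

lemma ftor_id_simps [simp]: "omap ftor_id A = A" "amap ftor_id f = f"
  by (simp_all add: ftor_id_def)

context is_ftor
begin

lemma omap_obj [simp]: "A \<in> Obj C \<Longrightarrow> omap F A \<in> Obj D"
  by (rule omap_in)

lemma amap_simps [simp]:
  assumes "f \<in> Arr C"
  shows "amap F f \<in> Arr D" "Dom D (amap F f) = omap F (Dom C f)"
    "Cod D (amap F f) = omap F (Cod C f)"
  using amap_in[OF C.HomI[OF assms refl refl]] by (simp_all add: Hom_def)

lemma amap_ident_simp [simp]: "A \<in> Obj C \<Longrightarrow> amap F (Ident C A) = Ident D (omap F A)"
  by (rule amap_ident)

lemma amap_comp_simp [simp]:
  assumes "f \<in> Arr C" "g \<in> Arr C" "Cod C f = Dom C g"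
  shows "amap F (g \<cdot>\<^bsub>C\<^esub> f) = amap F g \<cdot>\<^bsub>D\<^esub> amap F f"
  using assms by (intro amap_comp C.HomI) auto

lemma amap_eq:
  assumes "a \<cdot>\<^bsub>C\<^esub> b = c \<cdot>\<^bsub>C\<^esub> d"
    and "a \<in> Arr C" "b \<in> Arr C" "c \<in> Arr C" "d \<in> Arr C"
    and "Cod C b = Dom C a" "Cod C d = Dom C c"
  shows "amap F a \<cdot>\<^bsub>D\<^esub> amap F b = amap F c \<cdot>\<^bsub>D\<^esub> amap F d"
  using assms by (simp flip: amap_comp_simp)

lemma amap_iso [simp]:
  assumes "iso_arr C f"
  shows "iso_arr D (amap F f)"
  by (rule D.iso_arrI[of _ "amap F (inv_arr C f)"])
    (use assms C.iso_arr_arr[OF assms] in \<open>simp_all flip: amap_comp_simp\<close>)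

end

lemma is_ftor_id: "category C \<Longrightarrow> is_ftor C C ftor_id"
  by (simp add: is_ftor_def is_ftor_axioms_def)

lemma is_ftor_comp:
  assumes "is_ftor C D F" "is_ftor D E G"
  shows "is_ftor C E (G \<circ>\<^sub>F F)"
proof -
  interpret F: is_ftor C D F by fact
  interpret G: is_ftor D E G by fact
  show ?thesis
    by unfold_locales (auto simp: Hom_def)
qed

context nat_trans
begin

lemma component_simps [simp]:
  assumes "A \<in> Obj C"
  shows "\<tau> A \<in> Arr D" "Dom D (\<tau> A) = omap F A" "Cod D (\<tau> A) = omap G A"
  using component_in[OF assms] by (simp_all add: Hom_def)

lemma naturality:
  assumes "f \<in> Arr C"
  shows "\<tau> (Cod C f) \<cdot>\<^bsub>D\<^esub> amap F f = amap G f \<cdot>\<^bsub>D\<^esub> \<tau> (Dom C f)"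
  using assms by (intro natural F.C.HomI) simp_all

end

lemma (in nat_iso) component_iso_simp [simp]: "A \<in> Obj C \<Longrightarrow> iso_arr D (\<tau> A)"
  by (rule component_iso)

text \<open>Naturality is tested after composition with the invertible \<open>\<tau>' B\<close>:
  both sides then become \<open>amap H f\<close> after \<open>\<tau> A\<close>. The shape is that of
  \<open>square_iso\<close>, a \<open>comp_iso\<close> followed by the inverse of another.\<close>

lemma nat_iso_inv_comp:
  assumes "nat_iso C D F H \<tau>" "nat_iso C D G H \<tau>'"
  shows "nat_iso C D F G (\<lambda>A. inv_arr D (\<tau>' A) \<cdot>\<^bsub>D\<^esub> \<tau> A)"
proof -
  interpret \<tau>: nat_iso C D F H \<tau> by fact
  interpret \<tau>': nat_iso C D G H \<tau>' by fact
  show ?thesis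
  proof unfold_locales
    fix f A B assume "f \<in> Hom C A B"
    then have f [simp]: "f \<in> Arr C" "Dom C f = A" "Cod C f = B"
      by (auto simp: Hom_def)
    then have [simp]: "A \<in> Obj C" "B \<in> Obj C"
      using \<tau>.F.C.dom_cod_obj[of f] by auto
    have "\<tau>' B \<cdot>\<^bsub>D\<^esub> ((inv_arr D (\<tau>' B) \<cdot>\<^bsub>D\<^esub> \<tau> B) \<cdot>\<^bsub>D\<^esub> amap F f) = amap H f \<cdot>\<^bsub>D\<^esub> \<tau> A"
      using \<tau>.naturality[OF f(1)] by simp
    moreover have "\<tau>' B \<cdot>\<^bsub>D\<^esub> (amap G f \<cdot>\<^bsub>D\<^esub> (inv_arr D (\<tau>' A) \<cdot>\<^bsub>D\<^esub> \<tau> A)) = amap H f \<cdot>\<^bsub>D\<^esub> \<tau> A"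
      by (subst \<tau>.F.D.comp_eq_extend[OF \<tau>'.naturality[OF f(1), unfolded f]]) simp_all
    ultimately show "(inv_arr D (\<tau>' B) \<cdot>\<^bsub>D\<^esub> \<tau> B) \<cdot>\<^bsub>D\<^esub> amap F f =
        amap G f \<cdot>\<^bsub>D\<^esub> (inv_arr D (\<tau>' A) \<cdot>\<^bsub>D\<^esub> \<tau> A)"
      by - (rule \<tau>.F.D.iso_comp_left_cancel[of "\<tau>' B"], simp_all)
  qed (simp_all add: Hom_def)
qed


section \<open>Adjunctions and base change\<close>

sublocale is_right_adjoint \<subseteq> L: is_ftor C D L
  by (rule left_ftor)

sublocale is_right_adjoint \<subseteq> R: is_ftor D C "rfun R"
  by (rule right_ftor)

context is_right_adjoint
begin

text \<open>Transposition along the adjunction. Each round trip is naturality of the unit or the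
  counit, followed by one triangle identity.\<close>

lemma adjunct_bij:
  assumes [simp]: "A \<in> Obj C" "B \<in> Obj D"
  shows "bij_betw (\<lambda>v. counit R B \<cdot>\<^bsub>D\<^esub> amap L v) (Hom C A (omap (rfun R) B)) (Hom D (omap L A) B)"
proof (rule bij_betw_byWitness[where f' = "\<lambda>w. amap (rfun R) w \<cdot>\<^bsub>C\<^esub> unit R A"])
  show "\<forall>v\<in>Hom C A (omap (rfun R) B).
      amap (rfun R) (counit R B \<cdot>\<^bsub>D\<^esub> amap L v) \<cdot>\<^bsub>C\<^esub> unit R A = v"
  proof
    fix v assume "v \<in> Hom C A (omap (rfun R) B)"
    then have v [simp]: "v \<in> Arr C" "Dom C v = A" "Cod C v = omap (rfun R) B"
      by (auto simp: Hom_def)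
    have "amap (rfun R) (amap L v) \<cdot>\<^bsub>C\<^esub> unit R A = unit R (omap (rfun R) B) \<cdot>\<^bsub>C\<^esub> v"
      using \<eta>.naturality[OF v(1)] by simp
    then show "amap (rfun R) (counit R B \<cdot>\<^bsub>D\<^esub> amap L v) \<cdot>\<^bsub>C\<^esub> unit R A = v"
      using \<eta>.F.C.comp_eq_extend1[OF triangle_right[OF assms(2)], of v] by simp
  qed
  show "\<forall>w\<in>Hom D (omap L A) B.
      counit R B \<cdot>\<^bsub>D\<^esub> amap L (amap (rfun R) w \<cdot>\<^bsub>C\<^esub> unit R A) = w"
  proof
    fix w assume "w \<in> Hom D (omap L A) B"
    then have w [simp]: "w \<in> Arr D" "Dom D w = omap L A" "Cod D w = B"
      by (auto simp: Hom_def)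
    show "counit R B \<cdot>\<^bsub>D\<^esub> amap L (amap (rfun R) w \<cdot>\<^bsub>C\<^esub> unit R A) = w"
      using \<epsilon>.F.C.comp_eq_extend[OF \<epsilon>.naturality[OF w(1)], of "amap L (unit R A)"]
      by (simp add: triangle_left)
  qed
qed (auto simp: Hom_def)

end

text \<open>Used because \<open>square_iso_adj\<close> is a conjugate between adjoints of the two
  composites around a square. The triangle laws follow from those of the factors, after naturality
  of the counit of \<open>R1\<close> (respectively the unit of \<open>R2\<close>) exchanges the two
  middle arrows.\<close>

lemma is_right_adjoint_comp:
  assumes "is_right_adjoint C D L1 R1" "is_right_adjoint D E L2 R2"
  shows "is_right_adjoint C E (L2 \<circ>\<^sub>F L1) (radj_comp C E L2 R2 L1 R1)"
proof -
  interpret A: is_right_adjoint C D L1 R1 by fact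
  interpret B: is_right_adjoint D E L2 R2 by fact
  have ftors: "is_ftor C E (L2 \<circ>\<^sub>F L1)" "is_ftor E C (rfun R1 \<circ>\<^sub>F rfun R2)"
    by (auto intro: is_ftor_comp A.left_ftor B.left_ftor A.right_ftor B.right_ftor)
  interpret LL: is_ftor C E "L2 \<circ>\<^sub>F L1" by (fact ftors)
  interpret RR: is_ftor E C "rfun R1 \<circ>\<^sub>F rfun R2" by (fact ftors)
  have rf: "rfun (radj_comp C E L2 R2 L1 R1) = rfun R1 \<circ>\<^sub>F rfun R2"
    by (simp add: radj_comp_def)
  have 1: "nat_trans C C ftor_id (rfun (radj_comp C E L2 R2 L1 R1) \<circ>\<^sub>F (L2 \<circ>\<^sub>F L1))
      (unit (radj_comp C E L2 R2 L1 R1))"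
    unfolding rf
  proof (intro nat_trans.intro nat_trans_axioms.intro is_ftor_comp[OF ftors] is_ftor_id)
    fix f X Y assume "f \<in> Hom C X Y"
    then have f [simp]: "f \<in> Arr C" "Dom C f = X" "Cod C f = Y" and [simp]: "X \<in> Obj C" "Y \<in> Obj C"
      using A.\<eta>.F.C.dom_cod_obj[of f] by (auto simp: Hom_def)
    have "amap (rfun R1) (unit R2 (omap L1 Y)) \<cdot>\<^bsub>C\<^esub> amap (rfun R1) (amap L1 f) =
       amap (rfun R1) (amap (rfun R2) (amap L2 (amap L1 f))) \<cdot>\<^bsub>C\<^esub> amap (rfun R1) (unit R2 (omap L1 X))"
      by (rule A.R.amap_eq) (use B.\<eta>.naturality[of "amap L1 f"] in simp_all)
    from A.\<eta>.F.C.comp_eq_extend[OF this, of "unit R1 X"]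
    show "unit (radj_comp C E L2 R2 L1 R1) Y \<cdot>\<^bsub>C\<^esub> amap ftor_id f =
         amap ((rfun R1 \<circ>\<^sub>F rfun R2) \<circ>\<^sub>F L2 \<circ>\<^sub>F L1) f \<cdot>\<^bsub>C\<^esub> unit (radj_comp C E L2 R2 L1 R1) X"
      using A.\<eta>.naturality[OF f(1)] by (simp add: radj_comp_def)
  qed (auto simp: radj_comp_def Hom_def A.\<eta>.F.C.category_axioms)
  have 2: "nat_trans E E ((L2 \<circ>\<^sub>F L1) \<circ>\<^sub>F rfun (radj_comp C E L2 R2 L1 R1)) ftor_id
      (counit (radj_comp C E L2 R2 L1 R1))"
    unfolding rf
  proof (intro nat_trans.intro nat_trans_axioms.intro is_ftor_comp[OF ftors(2,1)] is_ftor_id)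
    fix f X Y assume "f \<in> Hom E X Y"
    then have f [simp]: "f \<in> Arr E" "Dom E f = X" "Cod E f = Y" and [simp]: "X \<in> Obj E" "Y \<in> Obj E"
      using B.\<epsilon>.F.C.dom_cod_obj[of f] by (auto simp: Hom_def)
    have "amap L2 (counit R1 (omap (rfun R2) Y)) \<cdot>\<^bsub>E\<^esub> amap L2 (amap L1 (amap (rfun R1) (amap (rfun R2) f))) =
       amap L2 (amap (rfun R2) f) \<cdot>\<^bsub>E\<^esub> amap L2 (counit R1 (omap (rfun R2) X))"
      by (rule B.L.amap_eq) (use A.\<epsilon>.naturality[of "amap (rfun R2) f"] in simp_all)
    then show "counit (radj_comp C E L2 R2 L1 R1) Y \<cdot>\<^bsub>E\<^esub>
          amap ((L2 \<circ>\<^sub>F L1) \<circ>\<^sub>F rfun R1 \<circ>\<^sub>F rfun R2) f =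
         amap ftor_id f \<cdot>\<^bsub>E\<^esub> counit (radj_comp C E L2 R2 L1 R1) X"
      using B.\<epsilon>.F.C.comp_eq_extend[OF B.\<epsilon>.naturality[OF f(1)], of "amap L2 (counit R1 (omap (rfun R2) X))"]
      by (simp add: radj_comp_def)
  qed (auto simp: radj_comp_def Hom_def B.\<epsilon>.F.C.category_axioms)
  show ?thesis
  proof (intro is_right_adjoint.intro is_right_adjoint_axioms.intro 1 2)
    fix X assume [simp]: "X \<in> Obj C"
    have "amap L2 (counit R1 (omap (rfun R2) (omap L2 (omap L1 X)))) \<cdot>\<^bsub>E\<^esub>
        amap L2 (amap L1 (amap (rfun R1) (unit R2 (omap L1 X)))) =
       amap L2 (unit R2 (omap L1 X)) \<cdot>\<^bsub>E\<^esub> amap L2 (counit R1 (omap L1 X))"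
      by (rule B.L.amap_eq) (use A.\<epsilon>.naturality[of "unit R2 (omap L1 X)"] in simp_all)
    from B.\<epsilon>.F.C.comp_eq_extend[OF this, of "amap L2 (amap L1 (unit R1 X))"]
    show "counit (radj_comp C E L2 R2 L1 R1) (omap (L2 \<circ>\<^sub>F L1) X) \<cdot>\<^bsub>E\<^esub>
          amap (L2 \<circ>\<^sub>F L1) (unit (radj_comp C E L2 R2 L1 R1) X) = Ident E (omap (L2 \<circ>\<^sub>F L1) X)"
      using A.triangle_left[of X] B.triangle_left[of "omap L1 X"]
      by (simp add: radj_comp_def flip: B.L.amap_comp_simp)
  next
    fix Y assume [simp]: "Y \<in> Obj E"
    have t: "amap (rfun R1) (amap (rfun R2) (counit R2 Y)) \<cdot>\<^bsub>C\<^esub> amap (rfun R1) (unit R2 (omap (rfun R2) Y)) =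
        Ident C (omap (rfun R1) (omap (rfun R2) Y))"
      by (simp add: B.triangle_right flip: A.R.amap_comp_simp)
    have "amap (rfun R1) (amap (rfun R2) (amap L2 (counit R1 (omap (rfun R2) Y)))) \<cdot>\<^bsub>C\<^esub>
        amap (rfun R1) (unit R2 (omap L1 (omap (rfun R1) (omap (rfun R2) Y)))) =
       amap (rfun R1) (unit R2 (omap (rfun R2) Y)) \<cdot>\<^bsub>C\<^esub> amap (rfun R1) (counit R1 (omap (rfun R2) Y))"
      by (rule A.R.amap_eq) (use B.\<eta>.naturality[of "counit R1 (omap (rfun R2) Y)"] in simp_all)
    from A.\<eta>.F.C.comp_eq_extend[OF this, of "unit R1 (omap (rfun R1) (omap (rfun R2) Y))"]
    show "amap (rfun (radj_comp C E L2 R2 L1 R1)) (counit (radj_comp C E L2 R2 L1 R1) Y) \<cdot>\<^bsub>C\<^esub>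
         unit (radj_comp C E L2 R2 L1 R1) (omap (rfun (radj_comp C E L2 R2 L1 R1)) Y) =
         Ident C (omap (rfun (radj_comp C E L2 R2 L1 R1)) Y)"
      using A.triangle_right[of "omap (rfun R2) Y"] t
      by (simp add: radj_comp_def)
  qed (use ftors in \<open>simp_all add: rf\<close>)
qed

text \<open>The second equation characterises the conjugate arrow, since transposition along
  \<open>L'\<close> is injective; it stands in for the explicit formula from here on. It is
  naturality of the counit of \<open>R'\<close> and a triangle identity.\<close>

lemma counit_radj_conjugate:
  assumes "is_right_adjoint C D L R" "is_right_adjoint C D L' R'" "nat_trans C D L' L \<alpha>"
    and [simp]: "B \<in> Obj D"
  shows "radj_conjugate C R R' \<alpha> B \<in> Hom C (omap (rfun R) B) (omap (rfun R') B)"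
    and "counit R' B \<cdot>\<^bsub>D\<^esub> amap L' (radj_conjugate C R R' \<alpha> B) = counit R B \<cdot>\<^bsub>D\<^esub> \<alpha> (omap (rfun R) B)"
proof -
  interpret A: is_right_adjoint C D L R by fact
  interpret B: is_right_adjoint C D L' R' by fact
  interpret \<alpha>: nat_trans C D L' L \<alpha> by fact
  show "radj_conjugate C R R' \<alpha> B \<in> Hom C (omap (rfun R) B) (omap (rfun R') B)"
    by (simp add: radj_conjugate_def Hom_def)
  let ?x = "counit R B \<cdot>\<^bsub>D\<^esub> \<alpha> (omap (rfun R) B)"
  have "counit R' B \<cdot>\<^bsub>D\<^esub> amap L' (amap (rfun R') ?x) =
        ?x \<cdot>\<^bsub>D\<^esub> counit R' (omap L' (omap (rfun R) B))"
    using B.\<epsilon>.naturality[of ?x] by simp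
  from A.\<epsilon>.F.C.comp_eq_extend[OF this, of "amap L' (unit R' (omap (rfun R) B))"]
  show "counit R' B \<cdot>\<^bsub>D\<^esub> amap L' (radj_conjugate C R R' \<alpha> B) = ?x"
    by (simp add: radj_conjugate_def B.triangle_left)
qed


section \<open>Squares in \<open>Delta0\<close> and their base change morphisms\<close>

locale cosimplicial_adjoints =
  pseudofunctor Delta0 X for X :: "('o, 'm) cosimp" +
  fixes R :: "darr \<Rightarrow> ('o, 'm, 'o, 'm) radj"
  assumes right_adjoints: "right_adjoints X R"
begin

lemma category_at: "category (cat_at X n)"
  by (rule cat_at) (simp add: Delta0_def)

lemma pull_adjoint:
  assumes "f \<in> Hom Delta0 m n"
  shows "is_right_adjoint (cat_at X m) (cat_at X n) (pull X f) (R f)"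
  using assms right_adjoints by (auto simp: right_adjoints_def Hom_def)

text \<open>A commuting square without the exactness conditions, its four cardinalities made
  explicit. (A2) enters the lemmas below as a \<open>base_change_iso\<close> hypothesis on one such
  square at a time.\<close>

definition commutes where
  "commutes a b c d f g f' g' \<longleftrightarrow> f \<in> Hom Delta0 a b \<and> g \<in> Hom Delta0 a c \<and>
     f' \<in> Hom Delta0 c d \<and> g' \<in> Hom Delta0 b d \<and> g' \<cdot>\<^bsub>Delta0\<^esub> f = f' \<cdot>\<^bsub>Delta0\<^esub> g"

lemma square_iso_nat_iso:
  assumes "commutes a b c d f g f' g'"
  shows "nat_iso (cat_at X a) (cat_at X d) (pull X f' \<circ>\<^sub>F pull X g) (pull X g' \<circ>\<^sub>F pull X f)
    (square_iso X f g f' g')"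
proof -
  have sq: "f \<in> Hom Delta0 a b" "g \<in> Hom Delta0 a c" "f' \<in> Hom Delta0 c d" "g' \<in> Hom Delta0 b d"
    "g' \<cdot>\<^bsub>Delta0\<^esub> f = f' \<cdot>\<^bsub>Delta0\<^esub> g"
    using assms by (auto simp: commutes_def)
  have "square_iso X f g f' g' =
      (\<lambda>A. inv_arr (cat_at X d) (comp_iso X g' f A) \<cdot>\<^bsub>cat_at X d\<^esub> comp_iso X f' g A)"
    using sq(4) by (auto simp: square_iso_def Let_def Hom_def)
  then show ?thesis
    using nat_iso_inv_comp[OF comp_iso[OF sq(2,3)] comp_iso[OF sq(1,4), unfolded sq(5)]] by simp
qed

text \<open>Base change is the transpose, along the adjunction of \<open>f'\<close>, of the square
  isomorphism followed by the counit of \<open>f\<close>. This replaces the threefold composite in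
  the definition.\<close>

lemma counit_base_change:
  assumes "commutes a b c d f g f' g'" and [simp]: "A \<in> Obj (cat_at X b)"
  shows "base_change X R f g f' g' A \<in>
      Hom (cat_at X c) (omap (pull X g) (omap (rfun (R f)) A)) (omap (rfun (R f')) (omap (pull X g') A))"
    and "counit (R f') (omap (pull X g') A) \<cdot>\<^bsub>cat_at X d\<^esub> amap (pull X f') (base_change X R f g f' g' A) =
      amap (pull X g') (counit (R f) A) \<cdot>\<^bsub>cat_at X d\<^esub> square_iso X f g f' g' (omap (rfun (R f)) A)"
proof -
  have sq: "f \<in> Hom Delta0 a b" "g \<in> Hom Delta0 a c" "f' \<in> Hom Delta0 c d" "g' \<in> Hom Delta0 b d"
    using assms by (auto simp: commutes_def)
  interpret Ca: category "cat_at X a" by (rule category_at)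
  interpret Cb: category "cat_at X b" by (rule category_at)
  interpret Cc: category "cat_at X c" by (rule category_at)
  interpret Cd: category "cat_at X d" by (rule category_at)
  interpret f: is_right_adjoint "cat_at X a" "cat_at X b" "pull X f" "R f"
    using sq by (simp add: pull_adjoint)
  interpret g: is_right_adjoint "cat_at X a" "cat_at X c" "pull X g" "R g"
    using sq by (simp add: pull_adjoint)
  interpret f': is_right_adjoint "cat_at X c" "cat_at X d" "pull X f'" "R f'"
    using sq by (simp add: pull_adjoint)
  interpret g': is_right_adjoint "cat_at X b" "cat_at X d" "pull X g'" "R g'"
    using sq by (simp add: pull_adjoint)
  interpret \<alpha>: nat_iso "cat_at X a" "cat_at X d" "pull X f' \<circ>\<^sub>F pull X g" "pull X g' \<circ>\<^sub>F pull X f"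
    "square_iso X f g f' g'"
    using assms(1) by (rule square_iso_nat_iso)
  define B where "B = omap (pull X g') A"
  have B [simp]: "B \<in> Obj (cat_at X d)" by (simp add: B_def)
  define \<beta> where "\<beta> = square_iso_adj X R f g f' g' B"
  have bc: "base_change X R f g f' g' A = counit (R g) (omap (rfun (R f')) B) \<cdot>\<^bsub>cat_at X c\<^esub>
      amap (pull X g) \<beta> \<cdot>\<^bsub>cat_at X c\<^esub> amap (pull X g) (amap (rfun (R f)) (unit (R g') A))"
    using sq(2) by (simp add: base_change_def Let_def \<beta>_def B_def Hom_def)
  have \<beta>_conj: "\<beta> = radj_conjugate (cat_at X a)
      (radj_comp (cat_at X a) (cat_at X d) (pull X g') (R g') (pull X f) (R f))
      (radj_comp (cat_at X a) (cat_at X d) (pull X f') (R f') (pull X g) (R g))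
      (square_iso X f g f' g') B"
    using sq(1,4) by (simp add: \<beta>_def square_iso_adj_def Let_def Hom_def)
  note conj = counit_radj_conjugate[OF
      is_right_adjoint_comp[OF f.is_right_adjoint_axioms g'.is_right_adjoint_axioms]
      is_right_adjoint_comp[OF g.is_right_adjoint_axioms f'.is_right_adjoint_axioms]
      \<alpha>.nat_trans_axioms B, folded \<beta>_conj]
  have \<beta> [simp]: "\<beta> \<in> Arr (cat_at X a)"
    "Dom (cat_at X a) \<beta> = omap (rfun (R f)) (omap (rfun (R g')) B)"
    "Cod (cat_at X a) \<beta> = omap (rfun (R g)) (omap (rfun (R f')) B)"
    using conj(1) by (auto simp: radj_comp_def Hom_def)
  have \<eta> [simp]: "Cod (cat_at X b) (unit (R g') A) = omap (rfun (R g')) B"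
    by (simp add: B_def)
  show "base_change X R f g f' g' A \<in>
      Hom (cat_at X c) (omap (pull X g) (omap (rfun (R f)) A)) (omap (rfun (R f')) (omap (pull X g') A))"
    by (simp add: bc Hom_def flip: B_def)
  let ?\<eta> = "amap (rfun (R f)) (unit (R g') A)"
  let ?\<alpha> = "square_iso X f g f' g'"
  let ?\<epsilon> = "counit (R f)"
  let ?RB = "omap (rfun (R g')) B"
  \<comment> \<open>The four facts are the conjugate equation at \<open>B\<close>, naturality of the
    square isomorphism, naturality of the counit of \<open>f\<close>, and the triangle identity of
    \<open>g'\<close>. Applied in this order, they move the unit of \<open>g'\<close> leftwards
    until it cancels.\<close>
  have 1: "counit (R f') B \<cdot>\<^bsub>cat_at X d\<^esub> amap (pull X f') (counit (R g) (omap (rfun (R f')) B)) \<cdot>\<^bsub>cat_at X d\<^esub>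
      amap (pull X f') (amap (pull X g) \<beta>) =
    counit (R g') B \<cdot>\<^bsub>cat_at X d\<^esub> amap (pull X g') (?\<epsilon> ?RB) \<cdot>\<^bsub>cat_at X d\<^esub>
      ?\<alpha> (omap (rfun (R f)) ?RB)"
    using conj(2) by (simp add: radj_comp_def)
  have 2: "?\<alpha> (omap (rfun (R f)) ?RB) \<cdot>\<^bsub>cat_at X d\<^esub> amap (pull X f') (amap (pull X g) ?\<eta>) =
      amap (pull X g') (amap (pull X f) ?\<eta>) \<cdot>\<^bsub>cat_at X d\<^esub> ?\<alpha> (omap (rfun (R f)) A)"
    using \<alpha>.naturality[of ?\<eta>] by simp
  have 3: "amap (pull X g') (?\<epsilon> ?RB) \<cdot>\<^bsub>cat_at X d\<^esub> amap (pull X g') (amap (pull X f) ?\<eta>) =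
      amap (pull X g') (unit (R g') A) \<cdot>\<^bsub>cat_at X d\<^esub> amap (pull X g') (?\<epsilon> A)"
    by (rule g'.L.amap_eq) (use f.\<epsilon>.naturality[of "unit (R g') A"] in simp_all)
  have 4: "counit (R g') B \<cdot>\<^bsub>cat_at X d\<^esub> amap (pull X g') (unit (R g') A) = Ident (cat_at X d) B"
    by (simp add: B_def g'.triangle_left)
  have "counit (R f') B \<cdot>\<^bsub>cat_at X d\<^esub> amap (pull X f') (base_change X R f g f' g' A) =
     (counit (R f') B \<cdot>\<^bsub>cat_at X d\<^esub> amap (pull X f') (counit (R g) (omap (rfun (R f')) B)) \<cdot>\<^bsub>cat_at X d\<^esub>
      amap (pull X f') (amap (pull X g) \<beta>)) \<cdot>\<^bsub>cat_at X d\<^esub> amap (pull X f') (amap (pull X g) ?\<eta>)"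
    by (simp add: bc)
  also have "\<dots> = counit (R g') B \<cdot>\<^bsub>cat_at X d\<^esub> amap (pull X g') (?\<epsilon> ?RB) \<cdot>\<^bsub>cat_at X d\<^esub>
      (?\<alpha> (omap (rfun (R f)) ?RB) \<cdot>\<^bsub>cat_at X d\<^esub> amap (pull X f') (amap (pull X g) ?\<eta>))"
    unfolding 1 by simp
  also have "\<dots> = counit (R g') B \<cdot>\<^bsub>cat_at X d\<^esub> (amap (pull X g') (?\<epsilon> ?RB) \<cdot>\<^bsub>cat_at X d\<^esub>
      amap (pull X g') (amap (pull X f) ?\<eta>)) \<cdot>\<^bsub>cat_at X d\<^esub> ?\<alpha> (omap (rfun (R f)) A)"
    unfolding 2 by simp
  also have "\<dots> = (counit (R g') B \<cdot>\<^bsub>cat_at X d\<^esub> amap (pull X g') (unit (R g') A)) \<cdot>\<^bsub>cat_at X d\<^esub>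
      amap (pull X g') (?\<epsilon> A) \<cdot>\<^bsub>cat_at X d\<^esub> ?\<alpha> (omap (rfun (R f)) A)"
    unfolding 3 by simp
  also have "\<dots> = amap (pull X g') (?\<epsilon> A) \<cdot>\<^bsub>cat_at X d\<^esub> ?\<alpha> (omap (rfun (R f)) A)"
    unfolding 4 by (simp add: B_def)
  finally show "counit (R f') (omap (pull X g') A) \<cdot>\<^bsub>cat_at X d\<^esub> amap (pull X f') (base_change X R f g f' g' A) =
      amap (pull X g') (?\<epsilon> A) \<cdot>\<^bsub>cat_at X d\<^esub> ?\<alpha> (omap (rfun (R f)) A)"
    by (simp add: B_def)
qed

text \<open>Composition with the invertible base change and transposition along \<open>f'\<close>
  are both bijective; \<open>counit_base_change\<close> rewrites their composite as the displayed
  formula, in which the right adjoint of \<open>f'\<close> no longer occurs.\<close>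

lemma mate_bij:
  assumes sq: "commutes a b c d f g f' g'" and bc: "base_change_iso X R f g f' g'"
    and A: "A \<in> Obj (cat_at X c)" and B [simp]: "B \<in> Obj (cat_at X b)"
  shows "bij_betw (\<lambda>v. amap (pull X g') (counit (R f) B) \<cdot>\<^bsub>cat_at X d\<^esub>
        square_iso X f g f' g' (omap (rfun (R f)) B) \<cdot>\<^bsub>cat_at X d\<^esub> amap (pull X f') v)
      (Hom (cat_at X c) A (omap (pull X g) (omap (rfun (R f)) B)))
      (Hom (cat_at X d) (omap (pull X f') A) (omap (pull X g') B))"
    (is "bij_betw ?\<Phi> ?S ?T")
proof -
  have hom: "f \<in> Hom Delta0 a b" "g \<in> Hom Delta0 a c" "f' \<in> Hom Delta0 c d" "g' \<in> Hom Delta0 b d"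
    using sq by (auto simp: commutes_def)
  interpret Cc: category "cat_at X c" by (rule category_at)
  interpret Cd: category "cat_at X d" by (rule category_at)
  interpret f: is_right_adjoint "cat_at X a" "cat_at X b" "pull X f" "R f"
    using hom by (simp add: pull_adjoint)
  interpret f': is_right_adjoint "cat_at X c" "cat_at X d" "pull X f'" "R f'"
    using hom by (simp add: pull_adjoint)
  interpret g': is_right_adjoint "cat_at X b" "cat_at X d" "pull X g'" "R g'"
    using hom by (simp add: pull_adjoint)
  interpret \<alpha>: nat_iso "cat_at X a" "cat_at X d" "pull X f' \<circ>\<^sub>F pull X g" "pull X g' \<circ>\<^sub>F pull X f"
    "square_iso X f g f' g'"
    using sq by (rule square_iso_nat_iso)
  interpret bc: nat_iso "cat_at X b" "cat_at X c" "pull X g \<circ>\<^sub>F rfun (R f)" "rfun (R f') \<circ>\<^sub>F pull X g'"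
    "base_change X R f g f' g'"
    using bc hom by (simp add: base_change_iso_def Hom_def)
  let ?bc = "base_change X R f g f' g' B"
  have "bij_betw (\<lambda>v. ?bc \<cdot>\<^bsub>cat_at X c\<^esub> v) ?S (Hom (cat_at X c) A (omap (rfun (R f')) (omap (pull X g') B)))"
    using Cc.iso_comp_bij[of ?bc A] by simp
  from bij_betw_trans[OF this f'.adjunct_bij[OF A]]
  have "bij_betw ((\<lambda>v. counit (R f') (omap (pull X g') B) \<cdot>\<^bsub>cat_at X d\<^esub> amap (pull X f') v) \<circ>
      (\<lambda>v. ?bc \<cdot>\<^bsub>cat_at X c\<^esub> v)) ?S ?T"
    by simp
  then show ?thesis
  proof (rule iffD1[OF bij_betw_cong, rotated])
    fix v assume "v \<in> ?S"
    then show "((\<lambda>v. counit (R f') (omap (pull X g') B) \<cdot>\<^bsub>cat_at X d\<^esub> amap (pull X f') v) \<circ>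
      (\<lambda>v. ?bc \<cdot>\<^bsub>cat_at X c\<^esub> v)) v = ?\<Phi> v"
      using Cd.comp_eq_extend[OF counit_base_change(2)[OF sq B], of "amap (pull X f') v"]
      by (simp add: Hom_def)
  qed
qed


end

section \<open>Gluing data attached to coactions\<close>

declare One_nat_def [simp del]

context cosimplicial_adjoints
begin

section \<open>Canonical isomorphisms between pullbacks from \<open>cat_at X 0\<close>\<close>

abbreviation e where "e \<equiv> dmap [] 1"

text \<open>The map \<open>e\<close> is the augmentation, from the empty set to one point;
  \<open>tmap\<close> and \<open>tobj\<close> are the resulting comonad on arrows and on
  objects.\<close>

abbreviation tmap where "tmap f \<equiv> amap (pull X e) (amap (rfun (R e)) f)"

abbreviation tobj where "tobj A \<equiv> omap (pull X e) (omap (rfun (R e)) A)"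

text \<open>Any two points \<open>q\<close> and \<open>q'\<close> agree after \<open>e\<close>,
  whose source is initial. The isomorphism therefore exists without any order relation between the
  points.\<close>

abbreviation \<sigma> where "\<sigma> q q' \<equiv> square_iso X e e q q'"

lemma e_hom: "e \<in> Hom Delta0 0 1"
  by (auto simp: Hom_def Delta0_def dmap_def mono_on_def)

lemma Cod_Delta: "Cod Delta = Cod Delta0"
  by (simp add: Delta_def full_subcat_def)

lemma Hom_Delta0_initial: "f \<in> Hom Delta0 0 n \<Longrightarrow> g \<in> Hom Delta0 0 n \<Longrightarrow> f = g"
  by (auto simp: Hom_def Delta0_def)

lemma comp_e_hom: "q \<in> Hom Delta0 1 n \<Longrightarrow> q \<cdot>\<^bsub>Delta0\<^esub> e \<in> Hom Delta0 0 n"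
  using category.comp_in[OF category_Delta0 e_hom] .

lemma comp_e_eq:
  assumes "q \<in> Hom Delta0 1 n" "q' \<in> Hom Delta0 1 n"
  shows "q \<cdot>\<^bsub>Delta0\<^esub> e = q' \<cdot>\<^bsub>Delta0\<^esub> e"
  using assms by (intro Hom_Delta0_initial comp_e_hom)

lemma commutes_e:
  assumes "q \<in> Hom Delta0 1 n" "q' \<in> Hom Delta0 1 n"
  shows "commutes 0 1 1 n e e q q'"
  using assms comp_e_eq[OF assms] e_hom by (simp add: commutes_def)

lemma \<sigma>_nat_iso:
  assumes "q \<in> Hom Delta0 1 n" "q' \<in> Hom Delta0 1 n"
  shows "nat_iso (cat_at X 0) (cat_at X n) (pull X q \<circ>\<^sub>F pull X e) (pull X q' \<circ>\<^sub>F pull X e) (\<sigma> q q')"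
  by (rule square_iso_nat_iso[OF commutes_e[OF assms]])

lemma \<sigma>_eq:
  assumes "q \<in> Hom Delta0 1 n" "q' \<in> Hom Delta0 1 n"
  shows "\<sigma> q q' B = inv_arr (cat_at X n) (comp_iso X q' e B) \<cdot>\<^bsub>cat_at X n\<^esub> comp_iso X q e B"
  using assms by (auto simp: square_iso_def Let_def Hom_def)

text \<open>Each \<open>\<sigma>\<close> is a quotient of two \<open>comp_iso\<close>, so adjacent
  factors cancel.\<close>

lemma \<sigma>_comp:
  assumes q: "q \<in> Hom Delta0 1 n" "q' \<in> Hom Delta0 1 n" "q'' \<in> Hom Delta0 1 n"
    and [simp]: "B \<in> Obj (cat_at X 0)"
  shows "\<sigma> q' q'' B \<cdot>\<^bsub>cat_at X n\<^esub> \<sigma> q q' B = \<sigma> q q'' B"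
    and "\<sigma> q q B = Ident (cat_at X n) (omap (pull X q) (omap (pull X e) B))"
proof -
  interpret Cn: category "cat_at X n" by (rule category_at)
  interpret q: nat_iso "cat_at X 0" "cat_at X n" "pull X q \<circ>\<^sub>F pull X e" "pull X (q \<cdot>\<^bsub>Delta0\<^esub> e)"
    "comp_iso X q e"
    using comp_iso[OF e_hom q(1)] .
  \<comment> \<open>All composites of points with \<open>e\<close> are equal; rewriting them to a
    single one gives the three isomorphisms a common codomain.\<close>
  interpret q': nat_iso "cat_at X 0" "cat_at X n" "pull X q' \<circ>\<^sub>F pull X e" "pull X (q \<cdot>\<^bsub>Delta0\<^esub> e)"
    "comp_iso X q' e"
    using comp_iso[OF e_hom q(2)] unfolding comp_e_eq[OF q(2,1)] .
  interpret q'': nat_iso "cat_at X 0" "cat_at X n" "pull X q'' \<circ>\<^sub>F pull X e" "pull X (q \<cdot>\<^bsub>Delta0\<^esub> e)"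
    "comp_iso X q'' e"
    using comp_iso[OF e_hom q(3)] unfolding comp_e_eq[OF q(3,1)] .
  show "\<sigma> q' q'' B \<cdot>\<^bsub>cat_at X n\<^esub> \<sigma> q q' B = \<sigma> q q'' B"
    using q by (simp add: \<sigma>_eq)
  show "\<sigma> q q B = Ident (cat_at X n) (omap (pull X q) (omap (pull X e) B))"
    using q by (simp add: \<sigma>_eq)
qed

text \<open>After composition with the invertible \<open>comp_iso\<close> of \<open>u q'\<close> and
  \<open>e\<close>, associativity coherence reduces both sides to the same arrow, which passes
  through the pullback along the common composite of the points with \<open>e\<close>.\<close>

lemma \<sigma>_pull:
  assumes q: "q \<in> Hom Delta0 1 n" "q' \<in> Hom Delta0 1 n" and u: "u \<in> Hom Delta0 n m"
    and [simp]: "B \<in> Obj (cat_at X 0)"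
  shows "comp_iso X u q' (omap (pull X e) B) \<cdot>\<^bsub>cat_at X m\<^esub> amap (pull X u) (\<sigma> q q' B) =
    \<sigma> (u \<cdot>\<^bsub>Delta0\<^esub> q) (u \<cdot>\<^bsub>Delta0\<^esub> q') B \<cdot>\<^bsub>cat_at X m\<^esub> comp_iso X u q (omap (pull X e) B)"
proof -
  have uq: "u \<cdot>\<^bsub>Delta0\<^esub> q \<in> Hom Delta0 1 m" "u \<cdot>\<^bsub>Delta0\<^esub> q' \<in> Hom Delta0 1 m"
    using category.comp_in[OF category_Delta0 q(1) u] category.comp_in[OF category_Delta0 q(2) u] .
  interpret Cn: category "cat_at X n" by (rule category_at)
  interpret Cm: category "cat_at X m" by (rule category_at)
  interpret e: is_ftor "cat_at X 0" "cat_at X 1" "pull X e" using pull[OF e_hom] .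
  interpret u: is_ftor "cat_at X n" "cat_at X m" "pull X u" using pull[OF u] .
  interpret q: nat_iso "cat_at X 0" "cat_at X n" "pull X q \<circ>\<^sub>F pull X e" "pull X (q \<cdot>\<^bsub>Delta0\<^esub> e)"
    "comp_iso X q e"
    using comp_iso[OF e_hom q(1)] .
  interpret q': nat_iso "cat_at X 0" "cat_at X n" "pull X q' \<circ>\<^sub>F pull X e" "pull X (q \<cdot>\<^bsub>Delta0\<^esub> e)"
    "comp_iso X q' e"
    using comp_iso[OF e_hom q(2)] unfolding comp_e_eq[OF q(2,1)] .
  interpret uq: nat_iso "cat_at X 1" "cat_at X m" "pull X u \<circ>\<^sub>F pull X q" "pull X (u \<cdot>\<^bsub>Delta0\<^esub> q)"
    "comp_iso X u q"
    using comp_iso[OF q(1) u] .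
  interpret uq': nat_iso "cat_at X 1" "cat_at X m" "pull X u \<circ>\<^sub>F pull X q'" "pull X (u \<cdot>\<^bsub>Delta0\<^esub> q')"
    "comp_iso X u q'"
    using comp_iso[OF q(2) u] .
  interpret uqe: nat_iso "cat_at X 0" "cat_at X m" "pull X (u \<cdot>\<^bsub>Delta0\<^esub> q) \<circ>\<^sub>F pull X e"
    "pull X ((u \<cdot>\<^bsub>Delta0\<^esub> q) \<cdot>\<^bsub>Delta0\<^esub> e)" "comp_iso X (u \<cdot>\<^bsub>Delta0\<^esub> q) e"
    using comp_iso[OF e_hom uq(1)] .
  interpret uqe': nat_iso "cat_at X 0" "cat_at X m" "pull X (u \<cdot>\<^bsub>Delta0\<^esub> q') \<circ>\<^sub>F pull X e"
    "pull X ((u \<cdot>\<^bsub>Delta0\<^esub> q) \<cdot>\<^bsub>Delta0\<^esub> e)" "comp_iso X (u \<cdot>\<^bsub>Delta0\<^esub> q') e"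
    using comp_iso[OF e_hom uq(2)] unfolding comp_e_eq[OF uq(2,1)] .
  interpret z: nat_iso "cat_at X 0" "cat_at X m" "pull X u \<circ>\<^sub>F pull X (q \<cdot>\<^bsub>Delta0\<^esub> e)"
    "pull X (u \<cdot>\<^bsub>Delta0\<^esub> (q \<cdot>\<^bsub>Delta0\<^esub> e))" "comp_iso X u (q \<cdot>\<^bsub>Delta0\<^esub> e)"
    using comp_iso[OF comp_e_hom[OF q(1)] u] .
  have qe: "q' \<cdot>\<^bsub>Delta0\<^esub> e = q \<cdot>\<^bsub>Delta0\<^esub> e"
    by (rule comp_e_eq[OF q(2,1)])
  note coh = assoc_coherence[OF e_hom q(1) u, of B] assoc_coherence[OF e_hom q(2) u, of B, unfolded qe]
  let ?L = "comp_iso X u q' (omap (pull X e) B) \<cdot>\<^bsub>cat_at X m\<^esub> amap (pull X u) (\<sigma> q q' B)"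
  let ?R = "\<sigma> (u \<cdot>\<^bsub>Delta0\<^esub> q) (u \<cdot>\<^bsub>Delta0\<^esub> q') B \<cdot>\<^bsub>cat_at X m\<^esub> comp_iso X u q (omap (pull X e) B)"
  have inv: "amap (pull X u) (comp_iso X q' e B) \<cdot>\<^bsub>cat_at X m\<^esub>
      amap (pull X u) (inv_arr (cat_at X n) (comp_iso X q' e B)) = Ident (cat_at X m) (omap (pull X u) (omap (pull X (q \<cdot>\<^bsub>Delta0\<^esub> e)) B))"
    by (simp flip: u.amap_comp_simp)
  have "comp_iso X (u \<cdot>\<^bsub>Delta0\<^esub> q') e B \<cdot>\<^bsub>cat_at X m\<^esub> ?L =
      (comp_iso X (u \<cdot>\<^bsub>Delta0\<^esub> q') e B \<cdot>\<^bsub>cat_at X m\<^esub> comp_iso X u q' (omap (pull X e) B)) \<cdot>\<^bsub>cat_at X m\<^esub>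
      amap (pull X u) (\<sigma> q q' B)"
    using q by (simp add: \<sigma>_eq)
  also have "\<dots> = comp_iso X u (q \<cdot>\<^bsub>Delta0\<^esub> e) B \<cdot>\<^bsub>cat_at X m\<^esub> amap (pull X u) (comp_iso X q e B)"
    unfolding coh(2)[OF assms(4)] using q Cm.comp_eq_extend1[OF inv, of "amap (pull X u) (comp_iso X q e B)"]
    by (simp add: \<sigma>_eq)
  also have "\<dots> = comp_iso X (u \<cdot>\<^bsub>Delta0\<^esub> q') e B \<cdot>\<^bsub>cat_at X m\<^esub> ?R"
    using uq by (simp add: \<sigma>_eq coh(1) category.comp_assoc[OF category_Delta0 e_hom q(1) u])
  finally show "?L = ?R"
    by - (rule Cm.iso_comp_left_cancel[of "comp_iso X (u \<cdot>\<^bsub>Delta0\<^esub> q') e B"], use q uq in \<open>simp_all add: \<sigma>_eq\<close>)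
qed

section \<open>Gluing maps and their calculus\<close>

definition coaction_map where
  "coaction_map n q q' G = amap (pull X q') (counit (R e) G) \<cdot>\<^bsub>cat_at X n\<^esub> \<sigma> q q' (omap (rfun (R e)) G)"

text \<open>The map \<open>coaction_map\<close> is the universal case, and any arrow
  \<open>h\<close> into \<open>tobj G\<close> is glued by composing with it. The source of
  \<open>h\<close> may differ from \<open>G\<close>, as iterating the comonad requires.\<close>

definition gluing where
  "gluing n q q' G h = coaction_map n q q' G \<cdot>\<^bsub>cat_at X n\<^esub> amap (pull X q) h"

lemma e_adjoint: "is_right_adjoint (cat_at X 0) (cat_at X 1) (pull X e) (R e)"
  by (rule pull_adjoint[OF e_hom])

lemma coaction_map_nat:
  assumes q: "q \<in> Hom Delta0 1 n" "q' \<in> Hom Delta0 1 n"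
  shows "nat_trans (cat_at X 1) (cat_at X n) (pull X q \<circ>\<^sub>F pull X e \<circ>\<^sub>F rfun (R e)) (pull X q')
    (coaction_map n q q')"
proof -
  interpret C1: category "cat_at X 1" by (rule category_at)
  interpret e: is_right_adjoint "cat_at X 0" "cat_at X 1" "pull X e" "R e" by (rule e_adjoint)
  interpret Cn: category "cat_at X n" by (rule category_at)
  interpret q: is_ftor "cat_at X 1" "cat_at X n" "pull X q" using pull[OF q(1)] .
  interpret q': is_ftor "cat_at X 1" "cat_at X n" "pull X q'" using pull[OF q(2)] .
  interpret \<sigma>: nat_iso "cat_at X 0" "cat_at X n" "pull X q \<circ>\<^sub>F pull X e" "pull X q' \<circ>\<^sub>F pull X e" "\<sigma> q q'"
    by (rule \<sigma>_nat_iso[OF q])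
  show ?thesis
  proof (intro nat_trans.intro nat_trans_axioms.intro
      is_ftor_comp[OF is_ftor_comp[OF e.right_ftor e.left_ftor] q.is_ftor_axioms] pull[OF q(2)])
    fix f A B assume "f \<in> Hom (cat_at X 1) A B"
    then have f [simp]: "f \<in> Arr (cat_at X 1)" "Dom (cat_at X 1) f = A" "Cod (cat_at X 1) f = B"
      and [simp]: "A \<in> Obj (cat_at X 1)" "B \<in> Obj (cat_at X 1)"
      using C1.dom_cod_obj[of f] by (auto simp: Hom_def)
    have 1: "\<sigma> q q' (omap (rfun (R e)) B) \<cdot>\<^bsub>cat_at X n\<^esub> amap (pull X q) (tmap f) =
        amap (pull X q') (tmap f) \<cdot>\<^bsub>cat_at X n\<^esub> \<sigma> q q' (omap (rfun (R e)) A)"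
      using \<sigma>.naturality[of "amap (rfun (R e)) f"] by simp
    have 2: "amap (pull X q') (counit (R e) B) \<cdot>\<^bsub>cat_at X n\<^esub> amap (pull X q') (tmap f) =
        amap (pull X q') f \<cdot>\<^bsub>cat_at X n\<^esub> amap (pull X q') (counit (R e) A)"
      by (rule q'.amap_eq) (use e.\<epsilon>.naturality[of f] in simp_all)
    show "coaction_map n q q' B \<cdot>\<^bsub>cat_at X n\<^esub> amap (pull X q \<circ>\<^sub>F pull X e \<circ>\<^sub>F rfun (R e)) f =
        amap (pull X q') f \<cdot>\<^bsub>cat_at X n\<^esub> coaction_map n q q' A"
      using 1 Cn.comp_eq_extend[OF 2, of "\<sigma> q q' (omap (rfun (R e)) A)"]
      by (simp add: coaction_map_def)
  qed (auto simp: coaction_map_def Hom_def)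
qed

text \<open>The comultiplication slides past \<open>\<sigma> q q'\<close>, cancels against the
  counit at \<open>tobj G\<close> by a triangle identity, and leaves two composable
  \<open>\<sigma>\<close>.\<close>

lemma coaction_map_comp:
  assumes q: "q \<in> Hom Delta0 1 n" "q' \<in> Hom Delta0 1 n" "q'' \<in> Hom Delta0 1 n"
    and [simp]: "G \<in> Obj (cat_at X 1)"
  shows "coaction_map n q' q'' G \<cdot>\<^bsub>cat_at X n\<^esub> coaction_map n q q' (tobj G) \<cdot>\<^bsub>cat_at X n\<^esub>
      amap (pull X q) (amap (pull X e) (unit (R e) (omap (rfun (R e)) G))) = coaction_map n q q'' G"
proof -
  interpret e: is_right_adjoint "cat_at X 0" "cat_at X 1" "pull X e" "R e" by (rule e_adjoint)
  interpret Cn: category "cat_at X n" by (rule category_at)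
  interpret q: is_ftor "cat_at X 1" "cat_at X n" "pull X q" using pull[OF q(1)] .
  interpret q': is_ftor "cat_at X 1" "cat_at X n" "pull X q'" using pull[OF q(2)] .
  interpret q'': is_ftor "cat_at X 1" "cat_at X n" "pull X q''" using pull[OF q(3)] .
  interpret \<sigma>: nat_iso "cat_at X 0" "cat_at X n" "pull X q \<circ>\<^sub>F pull X e" "pull X q' \<circ>\<^sub>F pull X e" "\<sigma> q q'"
    by (rule \<sigma>_nat_iso[OF q(1,2)])
  interpret \<sigma>': nat_iso "cat_at X 0" "cat_at X n" "pull X q' \<circ>\<^sub>F pull X e" "pull X q'' \<circ>\<^sub>F pull X e" "\<sigma> q' q''"
    by (rule \<sigma>_nat_iso[OF q(2,3)])
  let ?B = "omap (rfun (R e)) G"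
  have 1: "\<sigma> q q' (omap (rfun (R e)) (tobj G)) \<cdot>\<^bsub>cat_at X n\<^esub> amap (pull X q) (amap (pull X e) (unit (R e) ?B)) =
      amap (pull X q') (amap (pull X e) (unit (R e) ?B)) \<cdot>\<^bsub>cat_at X n\<^esub> \<sigma> q q' ?B"
    using \<sigma>.naturality[of "unit (R e) ?B"] by simp
  have 2: "amap (pull X q') (counit (R e) (tobj G)) \<cdot>\<^bsub>cat_at X n\<^esub>
      amap (pull X q') (amap (pull X e) (unit (R e) ?B)) = Ident (cat_at X n) (omap (pull X q') (tobj G))"
    by (simp add: e.triangle_left flip: q'.amap_comp_simp)
  show ?thesis
    using Cn.comp_eq_extend1[OF 2, of "\<sigma> q q' ?B"]
    by (simp add: coaction_map_def 1 \<sigma>_comp(1)[OF q])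
qed

text \<open>On the diagonal \<open>\<sigma>\<close> is the identity. This is how the counit law
  becomes visible in gluing maps.\<close>

lemma gluing_diag:
  assumes q: "q \<in> Hom Delta0 1 n" and h: "h \<in> Hom (cat_at X 1) F (tobj G)"
    and [simp]: "G \<in> Obj (cat_at X 1)"
  shows "gluing n q q G h = amap (pull X q) (counit (R e) G \<cdot>\<^bsub>cat_at X 1\<^esub> h)"
proof -
  interpret e: is_right_adjoint "cat_at X 0" "cat_at X 1" "pull X e" "R e" by (rule e_adjoint)
  interpret q: is_ftor "cat_at X 1" "cat_at X n" "pull X q" using pull[OF q(1)] .
  show ?thesis
    using h \<sigma>_comp(2)[OF q q q, of "omap (rfun (R e)) G"]
    by (simp add: gluing_def coaction_map_def Hom_def)
qed

lemma gluing_hom: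
  assumes q: "q \<in> Hom Delta0 1 n" "q' \<in> Hom Delta0 1 n" and h: "h \<in> Hom (cat_at X 1) F (tobj G)"
    and [simp]: "G \<in> Obj (cat_at X 1)"
  shows "gluing n q q' G h \<in> Hom (cat_at X n) (omap (pull X q) F) (omap (pull X q') G)"
proof -
  interpret q: is_ftor "cat_at X 1" "cat_at X n" "pull X q" using pull[OF q(1)] .
  interpret t: nat_trans "cat_at X 1" "cat_at X n" "pull X q \<circ>\<^sub>F pull X e \<circ>\<^sub>F rfun (R e)" "pull X q'"
    "coaction_map n q q'" by (rule coaction_map_nat[OF q])
  show ?thesis using h by (simp add: gluing_def Hom_def)
qed

lemma gluing_comp_right:
  assumes q: "q \<in> Hom Delta0 1 n" "q' \<in> Hom Delta0 1 n"
    and h: "h \<in> Hom (cat_at X 1) F (tobj G)" and f: "f \<in> Hom (cat_at X 1) E F"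
    and [simp]: "G \<in> Obj (cat_at X 1)"
  shows "gluing n q q' G (h \<cdot>\<^bsub>cat_at X 1\<^esub> f) = gluing n q q' G h \<cdot>\<^bsub>cat_at X n\<^esub> amap (pull X q) f"
proof -
  interpret q: is_ftor "cat_at X 1" "cat_at X n" "pull X q" using pull[OF q(1)] .
  interpret t: nat_trans "cat_at X 1" "cat_at X n" "pull X q \<circ>\<^sub>F pull X e \<circ>\<^sub>F rfun (R e)" "pull X q'"
    "coaction_map n q q'" by (rule coaction_map_nat[OF q])
  show ?thesis using h f by (simp add: gluing_def Hom_def)
qed

text \<open>Naturality of \<open>coaction_map\<close>. Together with
  \<open>gluing_comp_right\<close> it turns both sides of the condition on morphisms into gluing
  maps.\<close>

lemma gluing_comp_left:
  assumes q: "q \<in> Hom Delta0 1 n" "q' \<in> Hom Delta0 1 n"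
    and h: "h \<in> Hom (cat_at X 1) F (tobj G)" and f: "f \<in> Hom (cat_at X 1) G H"
  shows "gluing n q q' H (tmap f \<cdot>\<^bsub>cat_at X 1\<^esub> h) = amap (pull X q') f \<cdot>\<^bsub>cat_at X n\<^esub> gluing n q q' G h"
proof -
  interpret C1: category "cat_at X 1" by (rule category_at)
  interpret e: is_right_adjoint "cat_at X 0" "cat_at X 1" "pull X e" "R e" by (rule e_adjoint)
  interpret Cn: category "cat_at X n" by (rule category_at)
  interpret q: is_ftor "cat_at X 1" "cat_at X n" "pull X q" using pull[OF q(1)] .
  interpret q': is_ftor "cat_at X 1" "cat_at X n" "pull X q'" using pull[OF q(2)] .
  interpret t: nat_trans "cat_at X 1" "cat_at X n" "pull X q \<circ>\<^sub>F pull X e \<circ>\<^sub>F rfun (R e)" "pull X q'"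
    "coaction_map n q q'" by (rule coaction_map_nat[OF q])
  have f [simp]: "f \<in> Arr (cat_at X 1)" "Dom (cat_at X 1) f = G" "Cod (cat_at X 1) f = H"
    "G \<in> Obj (cat_at X 1)" "H \<in> Obj (cat_at X 1)"
    using f C1.dom_cod_obj[of f] by (auto simp: Hom_def)
  have [simp]: "h \<in> Arr (cat_at X 1)" "Cod (cat_at X 1) h = tobj G"
    using h by (auto simp: Hom_def)
  show ?thesis
    using Cn.comp_eq_extend[OF t.naturality[OF f(1), unfolded f ftor_comp_simps], of "amap (pull X q) h"]
    by (simp add: gluing_def)
qed

text \<open>Moving \<open>h\<close> through the first gluing map produces \<open>tmap h\<close>
  after \<open>h\<close>; coassociativity replaces it by the comultiplication after
  \<open>h\<close>, which \<open>coaction_map_comp\<close> contracts. The three points are in no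
  order, so the result also yields inverses.\<close>

lemma gluing_comp:
  assumes q: "q \<in> Hom Delta0 1 n" "q' \<in> Hom Delta0 1 n" "q'' \<in> Hom Delta0 1 n"
    and h: "h \<in> Hom (cat_at X 1) F (tobj F)" and [simp]: "F \<in> Obj (cat_at X 1)"
    and coassoc: "tmap h \<cdot>\<^bsub>cat_at X 1\<^esub> h =
      amap (pull X e) (unit (R e) (omap (rfun (R e)) F)) \<cdot>\<^bsub>cat_at X 1\<^esub> h"
  shows "gluing n q' q'' F h \<cdot>\<^bsub>cat_at X n\<^esub> gluing n q q' F h = gluing n q q'' F h"
proof -
  interpret e: is_right_adjoint "cat_at X 0" "cat_at X 1" "pull X e" "R e" by (rule e_adjoint)
  interpret Cn: category "cat_at X n" by (rule category_at)
  interpret q: is_ftor "cat_at X 1" "cat_at X n" "pull X q" using pull[OF q(1)] .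
  interpret q': is_ftor "cat_at X 1" "cat_at X n" "pull X q'" using pull[OF q(2)] .
  interpret t: nat_trans "cat_at X 1" "cat_at X n" "pull X q \<circ>\<^sub>F pull X e \<circ>\<^sub>F rfun (R e)" "pull X q'"
    "coaction_map n q q'" by (rule coaction_map_nat[OF q(1,2)])
  interpret t': nat_trans "cat_at X 1" "cat_at X n" "pull X q' \<circ>\<^sub>F pull X e \<circ>\<^sub>F rfun (R e)" "pull X q''"
    "coaction_map n q' q''" by (rule coaction_map_nat[OF q(2,3)])
  have [simp]: "h \<in> Arr (cat_at X 1)" "Dom (cat_at X 1) h = F" "Cod (cat_at X 1) h = tobj F"
    using h by (auto simp: Hom_def)
  let ?\<delta> = "amap (pull X e) (unit (R e) (omap (rfun (R e)) F))"
  have "gluing n q' q'' F h \<cdot>\<^bsub>cat_at X n\<^esub> gluing n q q' F h =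
      coaction_map n q' q'' F \<cdot>\<^bsub>cat_at X n\<^esub> (amap (pull X q') h \<cdot>\<^bsub>cat_at X n\<^esub> gluing n q q' F h)"
    using gluing_hom[OF q(1,2) h] by (simp add: gluing_def)
  also have "amap (pull X q') h \<cdot>\<^bsub>cat_at X n\<^esub> gluing n q q' F h = gluing n q q' (tobj F) (?\<delta> \<cdot>\<^bsub>cat_at X 1\<^esub> h)"
    using gluing_comp_left[OF q(1,2) h h] by (simp add: coassoc)
  also have "coaction_map n q' q'' F \<cdot>\<^bsub>cat_at X n\<^esub> \<dots> =
      (coaction_map n q' q'' F \<cdot>\<^bsub>cat_at X n\<^esub> coaction_map n q q' (tobj F) \<cdot>\<^bsub>cat_at X n\<^esub> amap (pull X q) ?\<delta>) \<cdot>\<^bsub>cat_at X n\<^esub>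
      amap (pull X q) h"
    by (simp add: gluing_def)
  also have "\<dots> = gluing n q q'' F h"
    by (subst coaction_map_comp[OF q]) (simp_all add: gluing_def)
  finally show ?thesis .
qed

text \<open>Naturality of \<open>comp_iso\<close> carries the counit and \<open>h\<close> across,
  and \<open>\<sigma>_pull\<close> the factor between them.\<close>

lemma gluing_pull:
  assumes q: "q \<in> Hom Delta0 1 n" "q' \<in> Hom Delta0 1 n" and u: "u \<in> Hom Delta0 n m"
    and h: "h \<in> Hom (cat_at X 1) F (tobj G)" and [simp]: "G \<in> Obj (cat_at X 1)"
  shows "comp_iso X u q' G \<cdot>\<^bsub>cat_at X m\<^esub> amap (pull X u) (gluing n q q' G h) =
    gluing m (u \<cdot>\<^bsub>Delta0\<^esub> q) (u \<cdot>\<^bsub>Delta0\<^esub> q') G h \<cdot>\<^bsub>cat_at X m\<^esub> comp_iso X u q F"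
proof -
  have uq: "u \<cdot>\<^bsub>Delta0\<^esub> q \<in> Hom Delta0 1 m" "u \<cdot>\<^bsub>Delta0\<^esub> q' \<in> Hom Delta0 1 m"
    using category.comp_in[OF category_Delta0 q(1) u] category.comp_in[OF category_Delta0 q(2) u] .
  interpret C1: category "cat_at X 1" by (rule category_at)
  interpret e: is_right_adjoint "cat_at X 0" "cat_at X 1" "pull X e" "R e" by (rule e_adjoint)
  interpret Cn: category "cat_at X n" by (rule category_at)
  interpret Cm: category "cat_at X m" by (rule category_at)
  interpret u: is_ftor "cat_at X n" "cat_at X m" "pull X u" using pull[OF u] .
  interpret q: is_ftor "cat_at X 1" "cat_at X n" "pull X q" using pull[OF q(1)] .
  interpret q': is_ftor "cat_at X 1" "cat_at X n" "pull X q'" using pull[OF q(2)] .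
  interpret \<sigma>: nat_iso "cat_at X 0" "cat_at X n" "pull X q \<circ>\<^sub>F pull X e" "pull X q' \<circ>\<^sub>F pull X e" "\<sigma> q q'"
    by (rule \<sigma>_nat_iso[OF q(1,2)])
  interpret \<sigma>': nat_iso "cat_at X 0" "cat_at X m" "pull X (u \<cdot>\<^bsub>Delta0\<^esub> q) \<circ>\<^sub>F pull X e"
    "pull X (u \<cdot>\<^bsub>Delta0\<^esub> q') \<circ>\<^sub>F pull X e" "\<sigma> (u \<cdot>\<^bsub>Delta0\<^esub> q) (u \<cdot>\<^bsub>Delta0\<^esub> q')"
    by (rule \<sigma>_nat_iso[OF uq])
  interpret uq: nat_iso "cat_at X 1" "cat_at X m" "pull X u \<circ>\<^sub>F pull X q" "pull X (u \<cdot>\<^bsub>Delta0\<^esub> q)"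
    "comp_iso X u q"
    using comp_iso[OF q(1) u] .
  interpret uq': nat_iso "cat_at X 1" "cat_at X m" "pull X u \<circ>\<^sub>F pull X q'" "pull X (u \<cdot>\<^bsub>Delta0\<^esub> q')"
    "comp_iso X u q'"
    using comp_iso[OF q(2) u] .
  have hs [simp]: "h \<in> Arr (cat_at X 1)" "Dom (cat_at X 1) h = F" "Cod (cat_at X 1) h = tobj G"
    "F \<in> Obj (cat_at X 1)"
    using h C1.dom_cod_obj[of h] by (auto simp: Hom_def)
  let ?B = "omap (rfun (R e)) G"
  let ?s = "amap (pull X u) (\<sigma> q q' ?B)" and ?h = "amap (pull X u) (amap (pull X q) h)"
  let ?s' = "\<sigma> (u \<cdot>\<^bsub>Delta0\<^esub> q) (u \<cdot>\<^bsub>Delta0\<^esub> q') ?B"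
  have 1: "comp_iso X u q' G \<cdot>\<^bsub>cat_at X m\<^esub> amap (pull X u) (amap (pull X q') (counit (R e) G)) =
     amap (pull X (u \<cdot>\<^bsub>Delta0\<^esub> q')) (counit (R e) G) \<cdot>\<^bsub>cat_at X m\<^esub> comp_iso X u q' (tobj G)"
    using uq'.naturality[of "counit (R e) G"] by simp
  have 2: "comp_iso X u q (tobj G) \<cdot>\<^bsub>cat_at X m\<^esub> ?h = amap (pull X (u \<cdot>\<^bsub>Delta0\<^esub> q)) h \<cdot>\<^bsub>cat_at X m\<^esub> comp_iso X u q F"
    using uq.naturality[of h] by simp
  have 3: "comp_iso X u q' (tobj G) \<cdot>\<^bsub>cat_at X m\<^esub> ?s = ?s' \<cdot>\<^bsub>cat_at X m\<^esub> comp_iso X u q (tobj G)"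
    by (rule \<sigma>_pull[OF q u]) simp
  have "comp_iso X u q' G \<cdot>\<^bsub>cat_at X m\<^esub> amap (pull X u) (gluing n q q' G h) =
    (comp_iso X u q' G \<cdot>\<^bsub>cat_at X m\<^esub> amap (pull X u) (amap (pull X q') (counit (R e) G))) \<cdot>\<^bsub>cat_at X m\<^esub> ?s \<cdot>\<^bsub>cat_at X m\<^esub> ?h"
    by (simp add: gluing_def coaction_map_def)
  also have "\<dots> = amap (pull X (u \<cdot>\<^bsub>Delta0\<^esub> q')) (counit (R e) G) \<cdot>\<^bsub>cat_at X m\<^esub>
      (comp_iso X u q' (tobj G) \<cdot>\<^bsub>cat_at X m\<^esub> ?s) \<cdot>\<^bsub>cat_at X m\<^esub> ?h"
    unfolding 1 by simp
  also have "\<dots> = amap (pull X (u \<cdot>\<^bsub>Delta0\<^esub> q')) (counit (R e) G) \<cdot>\<^bsub>cat_at X m\<^esub> ?s' \<cdot>\<^bsub>cat_at X m\<^esub>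
      (comp_iso X u q (tobj G) \<cdot>\<^bsub>cat_at X m\<^esub> ?h)"
    unfolding 3 by simp
  also have "\<dots> = gluing m (u \<cdot>\<^bsub>Delta0\<^esub> q) (u \<cdot>\<^bsub>Delta0\<^esub> q') G h \<cdot>\<^bsub>cat_at X m\<^esub> comp_iso X u q F"
    unfolding 2 by (simp add: gluing_def coaction_map_def)
  finally show ?thesis .
qed


section \<open>Descent conditions on gluing maps: bijectivity, invertibility, cocycles\<close>

lemma gluing_bij:
  assumes q: "q \<in> Hom Delta0 1 n" "q' \<in> Hom Delta0 1 n" and bc: "base_change_iso X R e e q q'"
    and F: "F \<in> Obj (cat_at X 1)" and G: "G \<in> Obj (cat_at X 1)"
  shows "bij_betw (gluing n q q' G) (Hom (cat_at X 1) F (tobj G))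
    (Hom (cat_at X n) (omap (pull X q) F) (omap (pull X q') G))"
proof -
  interpret C1: category "cat_at X 1" by (rule category_at)
  interpret Cn: category "cat_at X n" by (rule category_at)
  interpret e: is_right_adjoint "cat_at X 0" "cat_at X 1" "pull X e" "R e" by (rule e_adjoint)
  interpret q: is_ftor "cat_at X 1" "cat_at X n" "pull X q" using pull[OF q(1)] .
  interpret q': is_ftor "cat_at X 1" "cat_at X n" "pull X q'" using pull[OF q(2)] .
  interpret \<sigma>: nat_iso "cat_at X 0" "cat_at X n" "pull X q \<circ>\<^sub>F pull X e" "pull X q' \<circ>\<^sub>F pull X e" "\<sigma> q q'"
    by (rule \<sigma>_nat_iso[OF q])
  show ?thesis
  \<comment> \<open>In the square both initial legs are \<open>e\<close>, so the arrows treated by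
    \<open>mate_bij\<close> are exactly those into \<open>tobj G\<close>.\<close>
  proof (rule iffD1[OF bij_betw_cong mate_bij[OF commutes_e[OF q] bc F G]])
    fix v assume "v \<in> Hom (cat_at X 1) F (tobj G)"
    then show "amap (pull X q') (counit (R e) G) \<cdot>\<^bsub>cat_at X n\<^esub> \<sigma> q q' (omap (rfun (R e)) G) \<cdot>\<^bsub>cat_at X n\<^esub>
        amap (pull X q) v = gluing n q q' G v"
      using G by (simp add: gluing_def coaction_map_def Hom_def)
  qed
qed

text \<open>This is \<open>gluing_pull\<close> with one \<open>comp_iso\<close> brought to the other
  side. It turns the three arrows of the cocycle condition into gluing maps of the same
  \<open>h\<close> at pairs of points of the larger set.\<close>

lemma pull_along_gluing:
  assumes q: "q \<in> Hom Delta0 1 n" "q' \<in> Hom Delta0 1 n" and u: "u \<in> Hom Delta0 n m"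
    and h: "h \<in> Hom (cat_at X 1) F (tobj F)" and [simp]: "F \<in> Obj (cat_at X 1)"
  shows "pull_along X u q q' F (gluing n q q' F h) =
    gluing m (u \<cdot>\<^bsub>Delta0\<^esub> q) (u \<cdot>\<^bsub>Delta0\<^esub> q') F h"
proof -
  have uq: "u \<cdot>\<^bsub>Delta0\<^esub> q \<in> Hom Delta0 1 m" "u \<cdot>\<^bsub>Delta0\<^esub> q' \<in> Hom Delta0 1 m"
    using category.comp_in[OF category_Delta0 q(1) u] category.comp_in[OF category_Delta0 q(2) u] .
  interpret C1: category "cat_at X 1" by (rule category_at)
  interpret Cn: category "cat_at X n" by (rule category_at)
  interpret Cm: category "cat_at X m" by (rule category_at)
  interpret u: is_ftor "cat_at X n" "cat_at X m" "pull X u" using pull[OF u] .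
  interpret uq: nat_iso "cat_at X 1" "cat_at X m" "pull X u \<circ>\<^sub>F pull X q" "pull X (u \<cdot>\<^bsub>Delta0\<^esub> q)"
    "comp_iso X u q"
    using comp_iso[OF q(1) u] .
  interpret uq': nat_iso "cat_at X 1" "cat_at X m" "pull X u \<circ>\<^sub>F pull X q'" "pull X (u \<cdot>\<^bsub>Delta0\<^esub> q')"
    "comp_iso X u q'"
    using comp_iso[OF q(2) u] .
  have "pull_along X u q q' F (gluing n q q' F h) =
      comp_iso X u q' F \<cdot>\<^bsub>cat_at X m\<^esub> amap (pull X u) (gluing n q q' F h) \<cdot>\<^bsub>cat_at X m\<^esub>
      inv_arr (cat_at X m) (comp_iso X u q F)"
    using u by (simp add: pull_along_def Let_def Hom_def Cod_Delta)
  also have "\<dots> = gluing m (u \<cdot>\<^bsub>Delta0\<^esub> q) (u \<cdot>\<^bsub>Delta0\<^esub> q') F h"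
    using gluing_hom[OF q h] gluing_hom[OF uq h]
      Cm.comp_eq_extend[OF gluing_pull[OF q u h], of "inv_arr (cat_at X m) (comp_iso X u q F)"]
    by (simp add: Hom_def)
  finally show ?thesis .
qed

text \<open>The inverse is the gluing map of \<open>h\<close> with the points exchanged: by
  \<open>gluing_comp\<close> both composites are gluing maps from a point to itself, which the
  counit law makes identities.\<close>

lemma gluing_iso:
  assumes q: "q \<in> Hom Delta0 1 n" "q' \<in> Hom Delta0 1 n"
    and h: "h \<in> Hom (cat_at X 1) F (tobj F)" and F: "F \<in> Obj (cat_at X 1)"
    and counit: "counit (R e) F \<cdot>\<^bsub>cat_at X 1\<^esub> h = Ident (cat_at X 1) F"
    and coassoc: "tmap h \<cdot>\<^bsub>cat_at X 1\<^esub> h =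
      amap (pull X e) (unit (R e) (omap (rfun (R e)) F)) \<cdot>\<^bsub>cat_at X 1\<^esub> h"
  shows "iso_arr (cat_at X n) (gluing n q q' F h)"
proof -
  interpret Cn: category "cat_at X n" by (rule category_at)
  interpret q: is_ftor "cat_at X 1" "cat_at X n" "pull X q" using pull[OF q(1)] .
  interpret q': is_ftor "cat_at X 1" "cat_at X n" "pull X q'" using pull[OF q(2)] .
  show ?thesis
    by (rule Cn.iso_arrI[of _ "gluing n q' q F h"])
      (use gluing_hom[OF q h F] gluing_hom[OF q(2,1) h F] gluing_comp[OF q q(1) h F coassoc]
        gluing_comp[OF q(2,1,2) h F coassoc] gluing_diag[OF q(1) h F] gluing_diag[OF q(2) h F] counit F
        in \<open>simp_all add: Hom_def\<close>)
qed

text \<open>The canonical map from arrows \<open>F \<rightarrow> P\<^sub>e P\<^sub>e\<^sub>* P\<^sub>e P\<^sub>e\<^sub>* G\<close> to arrows \<open>P\<^sub>v\<^sub>p F \<rightarrow> P\<^sub>w\<^sub>p\<^sub>' G\<close> is injective: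
  it factors into base change along the squares \<open>(e, e, p, p')\<close> and \<open>(p, p', v, w)\<close>.\<close>

lemma iterated_gluing_inj:
  assumes p: "p \<in> Hom Delta0 1 n" "p' \<in> Hom Delta0 1 n" and bc1: "base_change_iso X R e e p p'"
    and sq: "commutes 1 n n m p p' v w" and bc2: "base_change_iso X R p p' v w"
    and F: "F \<in> Obj (cat_at X 1)" and G [simp]: "G \<in> Obj (cat_at X 1)"
    and k: "k \<in> Hom (cat_at X 1) F (tobj (tobj G))" "k' \<in> Hom (cat_at X 1) F (tobj (tobj G))"
    and eq: "coaction_map m (v \<cdot>\<^bsub>Delta0\<^esub> p') (w \<cdot>\<^bsub>Delta0\<^esub> p') G \<cdot>\<^bsub>cat_at X m\<^esub>
        gluing m (v \<cdot>\<^bsub>Delta0\<^esub> p) (v \<cdot>\<^bsub>Delta0\<^esub> p') (tobj G) k =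
      coaction_map m (v \<cdot>\<^bsub>Delta0\<^esub> p') (w \<cdot>\<^bsub>Delta0\<^esub> p') G \<cdot>\<^bsub>cat_at X m\<^esub>
        gluing m (v \<cdot>\<^bsub>Delta0\<^esub> p) (v \<cdot>\<^bsub>Delta0\<^esub> p') (tobj G) k'"
  shows "k = k'"
proof -
  have vw: "v \<in> Hom Delta0 n m" "w \<in> Hom Delta0 n m" and wp: "w \<cdot>\<^bsub>Delta0\<^esub> p = v \<cdot>\<^bsub>Delta0\<^esub> p'"
    using sq by (auto simp: commutes_def)
  have hom: "v \<cdot>\<^bsub>Delta0\<^esub> p \<in> Hom Delta0 1 m" "v \<cdot>\<^bsub>Delta0\<^esub> p' \<in> Hom Delta0 1 m" "w \<cdot>\<^bsub>Delta0\<^esub> p' \<in> Hom Delta0 1 m"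
    using category.comp_in[OF category_Delta0] p vw by blast+
  interpret C1: category "cat_at X 1" by (rule category_at)
  interpret Cn: category "cat_at X n" by (rule category_at)
  interpret Cm: category "cat_at X m" by (rule category_at)
  interpret e: is_right_adjoint "cat_at X 0" "cat_at X 1" "pull X e" "R e" by (rule e_adjoint)
  interpret p: is_right_adjoint "cat_at X 1" "cat_at X n" "pull X p" "R p" using pull_adjoint[OF p(1)] .
  interpret p': is_ftor "cat_at X 1" "cat_at X n" "pull X p'" using pull[OF p(2)] .
  interpret v: is_ftor "cat_at X n" "cat_at X m" "pull X v" using pull[OF vw(1)] .
  interpret w: is_ftor "cat_at X n" "cat_at X m" "pull X w" using pull[OF vw(2)] .
  interpret vp: nat_iso "cat_at X 1" "cat_at X m" "pull X v \<circ>\<^sub>F pull X p" "pull X (v \<cdot>\<^bsub>Delta0\<^esub> p)"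
    "comp_iso X v p" using comp_iso[OF p(1) vw(1)] .
  interpret vp': nat_iso "cat_at X 1" "cat_at X m" "pull X v \<circ>\<^sub>F pull X p'" "pull X (v \<cdot>\<^bsub>Delta0\<^esub> p')"
    "comp_iso X v p'" using comp_iso[OF p(2) vw(1)] .
  interpret wp: nat_iso "cat_at X 1" "cat_at X m" "pull X w \<circ>\<^sub>F pull X p" "pull X (v \<cdot>\<^bsub>Delta0\<^esub> p')"
    "comp_iso X w p" using comp_iso[OF p(1) vw(2)] unfolding wp .
  interpret wp': nat_iso "cat_at X 1" "cat_at X m" "pull X w \<circ>\<^sub>F pull X p'" "pull X (w \<cdot>\<^bsub>Delta0\<^esub> p')"
    "comp_iso X w p'" using comp_iso[OF p(2) vw(2)] .
  interpret \<alpha>: nat_iso "cat_at X 1" "cat_at X m" "pull X v \<circ>\<^sub>F pull X p'" "pull X w \<circ>\<^sub>F pull X p"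
    "square_iso X p p' v w" using sq by (rule square_iso_nat_iso)
  interpret bc: nat_iso "cat_at X 1" "cat_at X 1" "pull X e \<circ>\<^sub>F rfun (R e)" "rfun (R p) \<circ>\<^sub>F pull X p'"
    "base_change X R e e p p'"
    using bc1 e_hom by (simp add: base_change_iso_def Hom_def)
  interpret t: nat_trans "cat_at X 1" "cat_at X n" "pull X p \<circ>\<^sub>F pull X e \<circ>\<^sub>F rfun (R e)" "pull X p'"
    "coaction_map n p p'" by (rule coaction_map_nat[OF p])
  interpret t': nat_trans "cat_at X 1" "cat_at X m" "pull X (v \<cdot>\<^bsub>Delta0\<^esub> p') \<circ>\<^sub>F pull X e \<circ>\<^sub>F rfun (R e)"
    "pull X (w \<cdot>\<^bsub>Delta0\<^esub> p')" "coaction_map m (v \<cdot>\<^bsub>Delta0\<^esub> p') (w \<cdot>\<^bsub>Delta0\<^esub> p')"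
    by (rule coaction_map_nat[OF hom(2,3)])
  let ?\<alpha> = "square_iso X p p' v w"
  let ?t = "coaction_map m (v \<cdot>\<^bsub>Delta0\<^esub> p') (w \<cdot>\<^bsub>Delta0\<^esub> p') G"
  let ?bc = "base_change X R e e p p' G"
  \<comment> \<open>This is the bijection of \<open>mate_bij\<close> for the square of
    \<open>p\<close>, \<open>p'\<close>, \<open>v\<close>, \<open>w\<close>. The facts up to
    \<open>main\<close> express the arrows compared in the hypothesis through it.\<close>
  let ?\<Phi> = "\<lambda>x. amap (pull X w) (counit (R p) (omap (pull X p') G)) \<cdot>\<^bsub>cat_at X m\<^esub>
      ?\<alpha> (omap (rfun (R p)) (omap (pull X p') G)) \<cdot>\<^bsub>cat_at X m\<^esub> amap (pull X v) x"
  have \<alpha>: "?\<alpha> (tobj G) = inv_arr (cat_at X m) (comp_iso X w p (tobj G)) \<cdot>\<^bsub>cat_at X m\<^esub> comp_iso X v p' (tobj G)"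
    using vw by (simp add: square_iso_def Let_def Hom_def)
  \<comment> \<open>The gluing map of the identity of \<open>tobj G\<close> is
    \<open>coaction_map\<close> itself, so \<open>gluing_pull\<close> applies to it.\<close>
  have pw: "comp_iso X w p' G \<cdot>\<^bsub>cat_at X m\<^esub> amap (pull X w) (coaction_map n p p' G) =
      ?t \<cdot>\<^bsub>cat_at X m\<^esub> comp_iso X w p (tobj G)"
    using gluing_pull[OF p vw(2) C1.ident_in[of "tobj G"] G] p(1) hom(2)
      pull[OF p(1)] pull[OF hom(2)]
    by (simp add: gluing_def wp)
  have t: "?t \<cdot>\<^bsub>cat_at X m\<^esub> comp_iso X v p' (tobj G) =
      comp_iso X w p' G \<cdot>\<^bsub>cat_at X m\<^esub> amap (pull X w) (coaction_map n p p' G) \<cdot>\<^bsub>cat_at X m\<^esub> ?\<alpha> (tobj G)"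
    using Cm.comp_eq_extend[OF pw, of "?\<alpha> (tobj G)"] by (simp add: \<alpha>)
  \<comment> \<open>By \<open>counit_base_change\<close>, \<open>coaction_map\<close> is the
    transpose of base change along \<open>p\<close>; this brings in the counit of \<open>p\<close>
    that occurs in \<open>?\<Phi>\<close>.\<close>
  have bc: "amap (pull X w) (coaction_map n p p' G) = amap (pull X w) (counit (R p) (omap (pull X p') G)) \<cdot>\<^bsub>cat_at X m\<^esub>
      amap (pull X w) (amap (pull X p) ?bc)"
    using counit_base_change(2)[OF commutes_e[OF p] G] by (simp add: coaction_map_def flip: w.amap_comp_simp)
  have nat: "?\<alpha> (omap (rfun (R p)) (omap (pull X p') G)) \<cdot>\<^bsub>cat_at X m\<^esub> amap (pull X v) (amap (pull X p') ?bc) =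
      amap (pull X w) (amap (pull X p) ?bc) \<cdot>\<^bsub>cat_at X m\<^esub> ?\<alpha> (tobj G)"
    using \<alpha>.naturality[of ?bc] by simp
  \<comment> \<open>Up to invertible \<open>comp_iso\<close> factors, the arrow built from
    \<open>x\<close> is \<open>?\<Phi>\<close> of the gluing map of \<open>x\<close> followed by the
    pulled back base change.\<close>
  have main: "(?t \<cdot>\<^bsub>cat_at X m\<^esub> gluing m (v \<cdot>\<^bsub>Delta0\<^esub> p) (v \<cdot>\<^bsub>Delta0\<^esub> p') (tobj G) x) \<cdot>\<^bsub>cat_at X m\<^esub> comp_iso X v p F =
      comp_iso X w p' G \<cdot>\<^bsub>cat_at X m\<^esub> ?\<Phi> (amap (pull X p') ?bc \<cdot>\<^bsub>cat_at X n\<^esub> gluing n p p' (tobj G) x)"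
    if x: "x \<in> Hom (cat_at X 1) F (tobj (tobj G))" for x
  proof -
    let ?g = "gluing n p p' (tobj G) x"
    have [simp]: "?g \<in> Arr (cat_at X n)" "Cod (cat_at X n) ?g = omap (pull X p') (tobj G)"
      "Dom (cat_at X n) ?g = omap (pull X p) F"
      using gluing_hom[OF p x] by (auto simp: Hom_def)
    have "(?t \<cdot>\<^bsub>cat_at X m\<^esub> gluing m (v \<cdot>\<^bsub>Delta0\<^esub> p) (v \<cdot>\<^bsub>Delta0\<^esub> p') (tobj G) x) \<cdot>\<^bsub>cat_at X m\<^esub> comp_iso X v p F =
       (?t \<cdot>\<^bsub>cat_at X m\<^esub> comp_iso X v p' (tobj G)) \<cdot>\<^bsub>cat_at X m\<^esub> amap (pull X v) ?g"
      using gluing_pull[OF p vw(1) x] gluing_hom[OF hom(1,2) x] F by (simp add: Hom_def)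
    also have "\<dots> = comp_iso X w p' G \<cdot>\<^bsub>cat_at X m\<^esub> amap (pull X w) (counit (R p) (omap (pull X p') G)) \<cdot>\<^bsub>cat_at X m\<^esub>
      (amap (pull X w) (amap (pull X p) ?bc) \<cdot>\<^bsub>cat_at X m\<^esub> ?\<alpha> (tobj G)) \<cdot>\<^bsub>cat_at X m\<^esub> amap (pull X v) ?g"
      unfolding t bc by simp
    finally show ?thesis
      unfolding nat[symmetric] by simp
  qed
  have ph: "amap (pull X p') ?bc \<cdot>\<^bsub>cat_at X n\<^esub> gluing n p p' (tobj G) x \<in>
      Hom (cat_at X n) (omap (pull X p) F) (omap (pull X p') (omap (rfun (R p)) (omap (pull X p') G)))"
    if x: "x \<in> Hom (cat_at X 1) F (tobj (tobj G))" for x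
    using gluing_hom[OF p x] by (simp add: Hom_def)
  have bij: "bij_betw ?\<Phi>
     (Hom (cat_at X n) (omap (pull X p) F) (omap (pull X p') (omap (rfun (R p)) (omap (pull X p') G))))
     (Hom (cat_at X m) (omap (pull X v) (omap (pull X p) F)) (omap (pull X w) (omap (pull X p') G)))"
    by (rule mate_bij[OF sq bc2]) (simp_all add: F)
  \<comment> \<open>From here four injective operations are stripped off in turn: composition with
    \<open>comp_iso\<close>, \<open>?\<Phi>\<close>, composition with the pulled back base change,
    and \<open>gluing\<close>.\<close>
  have "comp_iso X w p' G \<cdot>\<^bsub>cat_at X m\<^esub> ?\<Phi> (amap (pull X p') ?bc \<cdot>\<^bsub>cat_at X n\<^esub> gluing n p p' (tobj G) k) =
      comp_iso X w p' G \<cdot>\<^bsub>cat_at X m\<^esub> ?\<Phi> (amap (pull X p') ?bc \<cdot>\<^bsub>cat_at X n\<^esub> gluing n p p' (tobj G) k')"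
    unfolding main[OF k(1), symmetric] main[OF k(2), symmetric] eq ..
  then have "?\<Phi> (amap (pull X p') ?bc \<cdot>\<^bsub>cat_at X n\<^esub> gluing n p p' (tobj G) k) =
      ?\<Phi> (amap (pull X p') ?bc \<cdot>\<^bsub>cat_at X n\<^esub> gluing n p p' (tobj G) k')"
    by - (rule Cm.iso_comp_left_cancel[of "comp_iso X w p' G"],
      use bij_betwE[OF bij] ph[OF k(1)] ph[OF k(2)] in \<open>simp_all add: Hom_def\<close>)
  then have "amap (pull X p') ?bc \<cdot>\<^bsub>cat_at X n\<^esub> gluing n p p' (tobj G) k =
      amap (pull X p') ?bc \<cdot>\<^bsub>cat_at X n\<^esub> gluing n p p' (tobj G) k'"
    using inj_onD[OF bij_betw_imp_inj_on[OF bij] _ ph[OF k(1)] ph[OF k(2)]] by blast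
  then have "gluing n p p' (tobj G) k = gluing n p p' (tobj G) k'"
    by - (rule Cn.iso_comp_left_cancel[of "amap (pull X p') ?bc"],
      use gluing_hom[OF p k(1)] gluing_hom[OF p k(2)] in \<open>simp_all add: Hom_def\<close>)
  then show ?thesis
    using inj_onD[OF bij_betw_imp_inj_on[OF gluing_bij[OF p bc1 F]] _ k] by simp
qed


text \<open>Followed by \<open>coaction_map\<close> from the second point to the third, the gluing
  map of \<open>tmap h\<close> after \<open>h\<close> is the composite of two gluing maps, and that
  of the comultiplication after \<open>h\<close> is the direct one. The cocycle condition equates
  the two, and \<open>iterated_gluing_inj\<close> removes the gluing.\<close>

lemma gluing_cocycle_imp_coassoc:
  assumes p: "p \<in> Hom Delta0 1 n" "p' \<in> Hom Delta0 1 n" and bc1: "base_change_iso X R e e p p'"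
    and sq: "commutes 1 n n m p p' v w" and bc2: "base_change_iso X R p p' v w"
    and F [simp]: "F \<in> Obj (cat_at X 1)" and h: "h \<in> Hom (cat_at X 1) F (tobj F)"
    and cocycle: "gluing m (v \<cdot>\<^bsub>Delta0\<^esub> p') (w \<cdot>\<^bsub>Delta0\<^esub> p') F h \<cdot>\<^bsub>cat_at X m\<^esub>
        gluing m (v \<cdot>\<^bsub>Delta0\<^esub> p) (v \<cdot>\<^bsub>Delta0\<^esub> p') F h =
      gluing m (v \<cdot>\<^bsub>Delta0\<^esub> p) (w \<cdot>\<^bsub>Delta0\<^esub> p') F h"
  shows "tmap h \<cdot>\<^bsub>cat_at X 1\<^esub> h =
      amap (pull X e) (unit (R e) (omap (rfun (R e)) F)) \<cdot>\<^bsub>cat_at X 1\<^esub> h"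
proof -
  have vw: "v \<in> Hom Delta0 n m" "w \<in> Hom Delta0 n m"
    using sq by (auto simp: commutes_def)
  define q q' q'' where q_def: "q = v \<cdot>\<^bsub>Delta0\<^esub> p" "q' = v \<cdot>\<^bsub>Delta0\<^esub> p'" "q'' = w \<cdot>\<^bsub>Delta0\<^esub> p'"
  have q: "q \<in> Hom Delta0 1 m" "q' \<in> Hom Delta0 1 m" "q'' \<in> Hom Delta0 1 m"
    unfolding q_def using category.comp_in[OF category_Delta0] p vw by blast+
  interpret C1: category "cat_at X 1" by (rule category_at)
  interpret Cm: category "cat_at X m" by (rule category_at)
  interpret e: is_right_adjoint "cat_at X 0" "cat_at X 1" "pull X e" "R e" by (rule e_adjoint)
  interpret q: is_ftor "cat_at X 1" "cat_at X m" "pull X q" using pull[OF q(1)] .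
  interpret q': is_ftor "cat_at X 1" "cat_at X m" "pull X q'" using pull[OF q(2)] .
  interpret t: nat_trans "cat_at X 1" "cat_at X m" "pull X q \<circ>\<^sub>F pull X e \<circ>\<^sub>F rfun (R e)" "pull X q'"
    "coaction_map m q q'" by (rule coaction_map_nat[OF q(1,2)])
  interpret t': nat_trans "cat_at X 1" "cat_at X m" "pull X q' \<circ>\<^sub>F pull X e \<circ>\<^sub>F rfun (R e)" "pull X q''"
    "coaction_map m q' q''" by (rule coaction_map_nat[OF q(2,3)])
  have [simp]: "h \<in> Arr (cat_at X 1)" "Dom (cat_at X 1) h = F" "Cod (cat_at X 1) h = tobj F"
    using h by (auto simp: Hom_def)
  let ?\<delta> = "amap (pull X e) (unit (R e) (omap (rfun (R e)) F))"
  have "coaction_map m q' q'' F \<cdot>\<^bsub>cat_at X m\<^esub> gluing m q q' (tobj F) (tmap h \<cdot>\<^bsub>cat_at X 1\<^esub> h) =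
      gluing m q' q'' F h \<cdot>\<^bsub>cat_at X m\<^esub> gluing m q q' F h"
    using gluing_comp_left[OF q(1,2) h h] gluing_hom[OF q(1,2) h]
    by (simp add: gluing_def[of m q' q''] Hom_def)
  also have "\<dots> = gluing m q q'' F h"
    using cocycle by (simp add: q_def)
  \<comment> \<open>Here \<open>coaction_map_comp\<close> is read from right to left, to insert the
    comultiplication.\<close>
  also have "\<dots> = (coaction_map m q' q'' F \<cdot>\<^bsub>cat_at X m\<^esub> coaction_map m q q' (tobj F) \<cdot>\<^bsub>cat_at X m\<^esub> amap (pull X q) ?\<delta>) \<cdot>\<^bsub>cat_at X m\<^esub>
      amap (pull X q) h"
    by (subst coaction_map_comp[OF q]) (simp_all add: gluing_def)
  also have "\<dots> = coaction_map m q' q'' F \<cdot>\<^bsub>cat_at X m\<^esub> gluing m q q' (tobj F) (?\<delta> \<cdot>\<^bsub>cat_at X 1\<^esub> h)"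
    by (simp add: gluing_def)
  finally show ?thesis
    unfolding q_def by (rule iterated_gluing_inj[OF p bc1 sq bc2 F F, rotated -1]) (simp_all add: Hom_def)
qed

text \<open>Coassociativity makes \<open>\<epsilon> \<circ> h\<close> idempotent.  Pulling the gluing isomorphism back along a
  common retraction \<open>s\<close> of \<open>p\<close> and \<open>p'\<close> shows that \<open>\<epsilon> \<circ> h\<close> is invertible, hence the identity.\<close>

lemma gluing_iso_imp_counit:
  assumes p: "p \<in> Hom Delta0 1 n" "p' \<in> Hom Delta0 1 n"
    and s: "s \<in> Hom Delta0 n 1" "s \<cdot>\<^bsub>Delta0\<^esub> p = Ident Delta0 1" "s \<cdot>\<^bsub>Delta0\<^esub> p' = Ident Delta0 1"
    and F [simp]: "F \<in> Obj (cat_at X 1)" and h: "h \<in> Hom (cat_at X 1) F (tobj F)"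
    and iso: "iso_arr (cat_at X n) (gluing n p p' F h)"
    and coassoc: "tmap h \<cdot>\<^bsub>cat_at X 1\<^esub> h =
      amap (pull X e) (unit (R e) (omap (rfun (R e)) F)) \<cdot>\<^bsub>cat_at X 1\<^esub> h"
  shows "counit (R e) F \<cdot>\<^bsub>cat_at X 1\<^esub> h = Ident (cat_at X 1) F"
proof -
  let ?i = "Ident Delta0 1" and ?t = "counit (R e) F \<cdot>\<^bsub>cat_at X 1\<^esub> h"
  have i: "?i \<in> Hom Delta0 1 1"
    by (rule category.ident_in[OF category_Delta0]) (simp add: Delta0_def)
  interpret C1: category "cat_at X 1" by (rule category_at)
  interpret Cn: category "cat_at X n" by (rule category_at)
  interpret e: is_right_adjoint "cat_at X 0" "cat_at X 1" "pull X e" "R e" by (rule e_adjoint)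
  interpret s: is_ftor "cat_at X n" "cat_at X 1" "pull X s" using pull[OF s(1)] .
  interpret i: is_ftor "cat_at X 1" "cat_at X 1" "pull X ?i" using pull[OF i] .
  interpret sp: nat_iso "cat_at X 1" "cat_at X 1" "pull X s \<circ>\<^sub>F pull X p" "pull X ?i"
    "comp_iso X s p" using comp_iso[OF p(1) s(1)] unfolding s .
  interpret sp': nat_iso "cat_at X 1" "cat_at X 1" "pull X s \<circ>\<^sub>F pull X p'" "pull X ?i"
    "comp_iso X s p'" using comp_iso[OF p(2) s(1)] unfolding s .
  interpret u: nat_iso "cat_at X 1" "cat_at X 1" ftor_id "pull X ?i" "unit_iso X 1"
    by (rule unit_iso) (simp add: Delta0_def)
  have hs [simp]: "h \<in> Arr (cat_at X 1)" "Dom (cat_at X 1) h = F" "Cod (cat_at X 1) h = tobj F"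
    using h by (auto simp: Hom_def)
  have g: "gluing n p p' F h \<in> Arr (cat_at X n)" "Dom (cat_at X n) (gluing n p p' F h) = omap (pull X p) F"
    "Cod (cat_at X n) (gluing n p p' F h) = omap (pull X p') F"
    using gluing_hom[OF p h] by (auto simp: Hom_def)
  \<comment> \<open>Since \<open>s\<close> sends both points to one, the pulled back gluing map lies
    on the diagonal, where it is the pullback of \<open>?t\<close> along the identity.\<close>
  have "comp_iso X s p' F \<cdot>\<^bsub>cat_at X 1\<^esub> amap (pull X s) (gluing n p p' F h) =
      amap (pull X ?i) ?t \<cdot>\<^bsub>cat_at X 1\<^esub> comp_iso X s p F"
    using gluing_pull[OF p s(1) h F] unfolding s gluing_diag[OF i h F] .
  then have "amap (pull X ?i) ?t = (comp_iso X s p' F \<cdot>\<^bsub>cat_at X 1\<^esub> amap (pull X s) (gluing n p p' F h)) \<cdot>\<^bsub>cat_at X 1\<^esub>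
      inv_arr (cat_at X 1) (comp_iso X s p F)"
    by simp
  moreover have "iso_arr (cat_at X 1) \<dots>"
    using iso g by simp
  ultimately have it: "iso_arr (cat_at X 1) (amap (pull X ?i) ?t)"
    by metis
  \<comment> \<open>Pullback along the identity is conjugate to the identity functor through
    \<open>unit_iso\<close>, which transfers invertibility to \<open>?t\<close>.\<close>
  have "unit_iso X 1 F \<cdot>\<^bsub>cat_at X 1\<^esub> ?t = amap (pull X ?i) ?t \<cdot>\<^bsub>cat_at X 1\<^esub> unit_iso X 1 F"
    using u.naturality[of ?t] by simp
  then have "?t = inv_arr (cat_at X 1) (unit_iso X 1 F) \<cdot>\<^bsub>cat_at X 1\<^esub> amap (pull X ?i) ?t \<cdot>\<^bsub>cat_at X 1\<^esub> unit_iso X 1 F"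
    using C1.inv_arr_cancel(1)[of "unit_iso X 1 F" ?t] by simp
  moreover have "iso_arr (cat_at X 1) \<dots>"
    using it by (simp del: i.amap_comp_simp)
  ultimately have t: "iso_arr (cat_at X 1) ?t"
    by metis
  \<comment> \<open>Naturality of the counit at \<open>h\<close> rewrites the middle of the square
    of \<open>?t\<close> and exposes \<open>tmap h\<close> after \<open>h\<close>; once
    coassociativity is applied, a triangle identity absorbs the comultiplication.\<close>
  have "h \<cdot>\<^bsub>cat_at X 1\<^esub> counit (R e) F = counit (R e) (tobj F) \<cdot>\<^bsub>cat_at X 1\<^esub> tmap h"
    using e.\<epsilon>.naturality[OF hs(1)] by simp
  then have "?t \<cdot>\<^bsub>cat_at X 1\<^esub> ?t = counit (R e) F \<cdot>\<^bsub>cat_at X 1\<^esub> counit (R e) (tobj F) \<cdot>\<^bsub>cat_at X 1\<^esub> (tmap h \<cdot>\<^bsub>cat_at X 1\<^esub> h)"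
    using C1.comp_eq_extend[of h "counit (R e) F" "counit (R e) (tobj F)" "tmap h" h] by simp
  also have "\<dots> = ?t"
    unfolding coassoc using C1.comp_eq_extend1[OF e.triangle_left[of "omap (rfun (R e)) F"], of h] by simp
  finally show ?thesis
    using C1.iso_idempotent_ident[OF t] by simp
qed

end


section \<open>Categories of structured objects\<close>

text \<open>Identity arrows serve as both natural isomorphisms.\<close>

lemma equivalent_categories_inverse_ftors:
  assumes "is_ftor C D F" "is_ftor D C G"
    and "\<And>A. A \<in> Obj C \<Longrightarrow> omap G (omap F A) = A" "\<And>f. f \<in> Arr C \<Longrightarrow> amap G (amap F f) = f"
    and "\<And>B. B \<in> Obj D \<Longrightarrow> omap F (omap G B) = B" "\<And>g. g \<in> Arr D \<Longrightarrow> amap F (amap G g) = g"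
  shows "equivalent_categories C D"
proof -
  interpret F: is_ftor C D F by fact
  interpret G: is_ftor D C G by fact
  have "nat_iso C C ftor_id (G \<circ>\<^sub>F F) (Ident C)"
    by (intro nat_iso.intro nat_trans.intro nat_trans_axioms.intro nat_iso_axioms.intro
        is_ftor_id is_ftor_comp[OF assms(1,2)] F.C.category_axioms)
      (auto simp: Hom_def assms)
  moreover have "nat_iso D D (F \<circ>\<^sub>F G) ftor_id (Ident D)"
    by (intro nat_iso.intro nat_trans.intro nat_trans_axioms.intro nat_iso_axioms.intro
        is_ftor_id is_ftor_comp[OF assms(2,1)] F.D.category_axioms)
      (auto simp: Hom_def assms)
  ultimately show ?thesis
    using assms(1,2) unfolding equivalent_categories_def by blast
qed

lemma category_struct_cat:
  assumes C: "category C"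
    and ident: "\<And>F s. F \<in> Obj C \<Longrightarrow> ob F s \<Longrightarrow> mor s s (Ident C F)"
    and comp: "\<And>F G H s t u f g. ob F s \<Longrightarrow> ob G t \<Longrightarrow> ob H u \<Longrightarrow> f \<in> Hom C F G \<Longrightarrow> g \<in> Hom C G H \<Longrightarrow>
      mor s t f \<Longrightarrow> mor t u g \<Longrightarrow> mor s u (g \<cdot>\<^bsub>C\<^esub> f)"
  shows "category (struct_cat C ob mor)"
proof -
  interpret category C by fact
  show ?thesis
    by unfold_locales
      (auto simp: struct_cat_def Hom_def ident intro: comp[unfolded Hom_def])
qed

definition struct_map where
  "struct_map b = (\<lambda>(F, s). (F, b F s))"

definition struct_ftor where
  "struct_ftor b = \<lparr>omap = struct_map b, amap = (\<lambda>(x, f, y). (struct_map b x, f, struct_map b y))\<rparr>"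

lemma is_ftor_struct_ftor:
  assumes "category (struct_cat C ob mor)" "category (struct_cat C ob' mor')"
    and "\<And>F s. F \<in> Obj C \<Longrightarrow> ob F s \<Longrightarrow> ob' F (b F s)"
    and "\<And>F G s t f. F \<in> Obj C \<Longrightarrow> G \<in> Obj C \<Longrightarrow> ob F s \<Longrightarrow> ob G t \<Longrightarrow> f \<in> Hom C F G \<Longrightarrow>
      mor s t f \<Longrightarrow> mor' (b F s) (b G t) f"
  shows "is_ftor (struct_cat C ob mor) (struct_cat C ob' mor') (struct_ftor b)"
  by (intro is_ftor.intro is_ftor_axioms.intro assms(1,2))
    (auto simp: struct_cat_def struct_ftor_def struct_map_def Hom_def assms(3) assms(4)[unfolded Hom_def])

text \<open>A fibrewise bijection \<open>b\<close> that preserves and reflects compatible arrows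
  gives strictly inverse functors fixing underlying objects and arrows. The laws for
  \<open>mor'\<close> are transported from those for \<open>mor\<close>, so they are checked on one
  side only.\<close>

lemma equivalent_struct_cats:
  assumes C: "category C"
    and ident: "\<And>F s. F \<in> Obj C \<Longrightarrow> ob F s \<Longrightarrow> mor s s (Ident C F)"
    and comp: "\<And>F G H s t u f g. ob F s \<Longrightarrow> ob G t \<Longrightarrow> ob H u \<Longrightarrow> f \<in> Hom C F G \<Longrightarrow> g \<in> Hom C G H \<Longrightarrow>
      mor s t f \<Longrightarrow> mor t u g \<Longrightarrow> mor s u (g \<cdot>\<^bsub>C\<^esub> f)"
    and bij: "\<And>F. F \<in> Obj C \<Longrightarrow> bij_betw (b F) {s. ob F s} {s. ob' F s}"
    and mor: "\<And>F G s t f. F \<in> Obj C \<Longrightarrow> G \<in> Obj C \<Longrightarrow> ob F s \<Longrightarrow> ob G t \<Longrightarrow> f \<in> Hom C F G \<Longrightarrow>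
      mor' (b F s) (b G t) f \<longleftrightarrow> mor s t f"
  shows "equivalent_categories (struct_cat C ob' mor') (struct_cat C ob mor)"
proof -
  interpret category C by fact
  define b' where "b' F = inv_into {s. ob F s} (b F)" for F
  have ob': "ob' F (b F s)" if "F \<in> Obj C" "ob F s" for F s
    using bij_betwE[OF bij[OF that(1)]] that(2) by blast
  have b'b: "b' F (b F s) = s" if "F \<in> Obj C" "ob F s" for F s
    using bij_betw_inv_into_left[OF bij[OF that(1)]] that(2) by (simp add: b'_def)
  have ob: "ob F (b' F s)" if "F \<in> Obj C" "ob' F s" for F s
    using bij_betwE[OF bij_betw_inv_into[OF bij[OF that(1)]]] that(2) by (simp add: b'_def)
  have bb': "b F (b' F s) = s" if "F \<in> Obj C" "ob' F s" for F s
    using bij_betw_inv_into_right[OF bij[OF that(1)]] that(2) by (simp add: b'_def)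
  \<comment> \<open>The condition on arrows concerns structures of the form \<open>b F s\<close>;
    through the inverse it extends to all admissible structures of the other kind.\<close>
  have mor'_iff: "mor' s t f \<longleftrightarrow> mor (b' F s) (b' G t) f"
    if "ob' F s" "ob' G t" "f \<in> Hom C F G" for F G s t f
  proof -
    have FG: "F \<in> Obj C" "G \<in> Obj C"
      using that(3) by (auto simp: Hom_def)
    show ?thesis
      using mor[OF FG ob[OF FG(1) that(1)] ob[OF FG(2) that(2)] that(3)] that FG by (simp add: bb')
  qed
  have 1: "category (struct_cat C ob mor)"
    using C ident comp by (rule category_struct_cat)
  have 2: "category (struct_cat C ob' mor')"
  proof (rule category_struct_cat[OF C])
    show "mor' s s (Ident C F)" if "F \<in> Obj C" "ob' F s" for F s
      using mor'_iff[OF that(2,2) ident_in] that ident ob by blast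
    fix F G H s t u f g
    assume *: "ob' F s" "ob' G t" "ob' H u" "f \<in> Hom C F G" "g \<in> Hom C G H" "mor' s t f" "mor' t u g"
    have "F \<in> Obj C" "G \<in> Obj C" "H \<in> Obj C"
      using *(4,5) by (auto simp: Hom_def)
    then show "mor' s u (g \<cdot>\<^bsub>C\<^esub> f)"
      using * mor'_iff[OF *(1,2,4)] mor'_iff[OF *(2,3,5)] mor'_iff[OF *(1,3) comp_in[OF *(4,5)]]
        comp[OF ob ob ob *(4,5)] by blast
  qed
  show ?thesis
  proof (rule equivalent_categories_inverse_ftors)
    show "is_ftor (struct_cat C ob' mor') (struct_cat C ob mor) (struct_ftor b')"
      by (rule is_ftor_struct_ftor[OF 2 1]) (auto simp: ob mor'_iff)
    show "is_ftor (struct_cat C ob mor) (struct_cat C ob' mor') (struct_ftor b)"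
      by (rule is_ftor_struct_ftor[OF 1 2]) (auto simp: ob' mor)
  qed (auto simp: struct_cat_def struct_ftor_def struct_map_def b'b bb')
qed


section \<open>Comparison of the descent categories\<close>

lemma dmap_hom:
  assumes "sorted js" "set js \<subseteq> {1..n}"
  shows "dmap js n \<in> Hom Delta0 (length js) n"
proof -
  have "js ! (i - 1) \<in> {1..n}" if "i \<in> {1..length js}" for i
    using assms(2) nth_mem[of "i - 1" js] that by (auto simp: subset_iff)
  moreover have "js ! (i - 1) \<le> js ! (j - 1)" if "i \<in> {1..length js}" "j \<in> {1..length js}" "i \<le> j" for i j
    using that by (intro sorted_nth_mono[OF assms(1)]) auto
  ultimately show ?thesis
    by (auto simp: Hom_def Delta0_def dmap_def mono_on_def)
qed

text \<open>Composition is list lookup, shifted by one because points count from 1 and list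
  positions from 0.\<close>

lemma dmap_comp:
  assumes "set js \<subseteq> {1..length ks}"
  shows "dmap ks n \<cdot>\<^bsub>Delta0\<^esub> dmap js (length ks) = dmap (map (\<lambda>j. ks ! (j - 1)) js) n"
proof -
  have "js ! (i - 1) \<in> {1..length ks}" if "i \<in> {1..length js}" for i
    using assms nth_mem[of "i - 1" js] that by (auto simp: subset_iff)
  then show ?thesis
    by (auto simp: Delta0_def dmap_def compose_def fun_eq_iff)
qed

lemma dfun_dmap: "dfun (dmap js n) = (\<lambda>i\<in>{1..length js}. js ! (i - 1))"
  by (simp add: dfun_def dmap_def)

text \<open>The descent category involves only sets of one, two and three points and maps between
  them. All of these lie in \<open>Delta\<close>, where the restrictions in \<open>Sk0\<close>
  change nothing.\<close>

lemma Kern_Sk0: "Kern (Sk0 X) = Kern X"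
proof -
  have a: "dmap [1] 2 \<in> Arr Delta" "dmap [2] 2 \<in> Arr Delta"
    "dmap [1, 2] 3 \<in> Arr Delta" "dmap [1, 3] 3 \<in> Arr Delta" "dmap [2, 3] 3 \<in> Arr Delta"
    using dmap_hom[of "[1]" 2] dmap_hom[of "[2]" 2] dmap_hom[of "[1, 2]" 3] dmap_hom[of "[1, 3]" 3]
      dmap_hom[of "[2, 3]" 3]
    by (auto simp: Delta_def full_subcat_def Hom_def)
  have c: "cat_at (Sk0 X) n = cat_at X n" if "1 \<le> n" for n
    using that by (simp add: Sk0_def Delta_simps)
  have p: "pull (Sk0 X) f = pull X f" if "f \<in> Arr Delta" for f
    using that by (simp add: Sk0_def)
  have l: "pull_along (Sk0 X) u q q' = pull_along X u q q'"
    if "u \<in> Arr Delta" "q \<in> Arr Delta" "q' \<in> Arr Delta" for u q q'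
  proof -
    have "Cod Delta u \<in> Obj Delta"
      using category.cod_in[OF category_Delta that(1)] .
    then have "cat_at (Sk0 X) (Cod Delta u) = cat_at X (Cod Delta u)"
      by (simp add: Sk0_def)
    then show ?thesis
      using that by (simp add: pull_along_def fun_eq_iff p) (simp add: Sk0_def)
  qed
  show ?thesis
    by (simp add: Kern_def Let_def a c p l)
qed

section \<open>Gluing data and comodules correspond\<close>

theorem proposition4p2:
  fixes X :: "('o, 'm) cosimp"
    and R :: "darr \<Rightarrow> ('o, 'm, 'o, 'm) radj"
  assumes "augmented_cosimplicial X"
    and "right_adjoints X R"
    and "exact_base_change X R"
  shows "equivalent_categories (Kern (Sk0 X)) (comonad_descent X R)"
proof -
  interpret cosimplicial_adjoints X R
    using assms(1,2) by (simp add: cosimplicial_adjoints_def cosimplicial_adjoints_axioms_def)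
  \<comment> \<open>The map \<open>s\<close> collapses two points to one and is the common
    retraction of \<open>p1\<close> and \<open>p2\<close> needed for the counit law.\<close>
  define p1 p2 p12 p13 p23 s where p_defs: "p1 = dmap [1] 2" "p2 = dmap [2] 2"
    "p12 = dmap [1, 2] 3" "p13 = dmap [1, 3] 3" "p23 = dmap [2, 3] 3" "s = dmap [1, 1] 1"
  have p: "p1 \<in> Hom Delta0 1 2" "p2 \<in> Hom Delta0 1 2"
    and v: "p12 \<in> Hom Delta0 2 3" "p13 \<in> Hom Delta0 2 3" "p23 \<in> Hom Delta0 2 3"
    and s: "s \<in> Hom Delta0 2 1"
    using dmap_hom[of "[1]" 2] dmap_hom[of "[2]" 2] dmap_hom[of "[1, 2]" 3] dmap_hom[of "[1, 3]" 3]
      dmap_hom[of "[2, 3]" 3] dmap_hom[of "[1, 1]" 1]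
    by (auto simp: p_defs numeral_2_eq_2 One_nat_def)
  have sp: "s \<cdot>\<^bsub>Delta0\<^esub> p1 = Ident Delta0 1" "s \<cdot>\<^bsub>Delta0\<^esub> p2 = Ident Delta0 1"
    by (auto simp: p_defs Delta0_def dmap_def compose_def fun_eq_iff)
  have comps: "p12 \<cdot>\<^bsub>Delta0\<^esub> p1 = dmap [1] 3" "p12 \<cdot>\<^bsub>Delta0\<^esub> p2 = dmap [2] 3"
    "p13 \<cdot>\<^bsub>Delta0\<^esub> p1 = dmap [1] 3" "p13 \<cdot>\<^bsub>Delta0\<^esub> p2 = dmap [3] 3"
    "p23 \<cdot>\<^bsub>Delta0\<^esub> p1 = dmap [2] 3" "p23 \<cdot>\<^bsub>Delta0\<^esub> p2 = dmap [3] 3"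
    using dmap_comp[of "[1]" "[1, 2]" 3] dmap_comp[of "[2]" "[1, 2]" 3] dmap_comp[of "[1]" "[1, 3]" 3]
      dmap_comp[of "[2]" "[1, 3]" 3] dmap_comp[of "[1]" "[2, 3]" 3] dmap_comp[of "[2]" "[2, 3]" 3]
    by (auto simp: p_defs numeral_2_eq_2 One_nat_def)
  have q: "dmap [1] 3 \<in> Hom Delta0 1 3" "dmap [2] 3 \<in> Hom Delta0 1 3" "dmap [3] 3 \<in> Hom Delta0 1 3"
    using dmap_hom[of "[1]" 3] dmap_hom[of "[2]" 3] dmap_hom[of "[3]" 3] by (auto simp: One_nat_def)
  have sets: "{1..2::nat} = {1, 2}" "{1..3::nat} = {1, 2, 3}" by auto
  \<comment> \<open>Cardinalities 0, 1, 1, 2: a two-point set is the union of its points, glued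
    along the empty set.\<close>
  have "exact_cartesian e e p1 p2"
    unfolding exact_cartesian_def
    using commutes_e[OF p] by (intro exI[of _ 0] exI[of _ 1] exI[of _ 2])
      (auto simp: commutes_def p_defs dfun_dmap sets)
  then have bc1: "base_change_iso X R e e p1 p2"
    using assms(3) unfolding exact_base_change_def by blast
  \<comment> \<open>The images of \<open>p12\<close> and \<open>p23\<close> cover the three-point
    set and overlap in the point 2, the second point of the former and the first of the latter. The
    cardinalities 1, 2, 2, 3 fit an exact square.\<close>
  have sq: "commutes 1 2 2 3 p1 p2 p12 p23"
    using p v by (simp add: commutes_def comps)
  then have "exact_cartesian p1 p2 p12 p23"
    unfolding exact_cartesian_def
    by (intro exI[of _ 1] exI[of _ 2] exI[of _ 3])
      (auto simp: commutes_def p_defs dfun_dmap sets)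
  then have bc2: "base_change_iso X R p1 p2 p12 p23"
    using assms(3) unfolding exact_base_change_def by blast
  interpret C1: category "cat_at X 1" by (rule category_at)
  interpret e: is_right_adjoint "cat_at X 0" "cat_at X 1" "pull X e" "R e" by (rule e_adjoint)
  \<comment> \<open>The four predicates copy the conditions in \<open>comonad_descent\<close> and
    \<open>Kern\<close>, so that the final identifications hold by unfolding.\<close>
  define coact where "coact F h \<longleftrightarrow> h \<in> Hom (cat_at X 1) F (tobj F) \<and>
      counit (R e) F \<cdot>\<^bsub>cat_at X 1\<^esub> h = Ident (cat_at X 1) F \<and>
      tmap h \<cdot>\<^bsub>cat_at X 1\<^esub> h = amap (pull X e) (unit (R e) (omap (rfun (R e)) F)) \<cdot>\<^bsub>cat_at X 1\<^esub> h" for F h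
  define comor where "comor h1 h2 f \<longleftrightarrow> h2 \<cdot>\<^bsub>cat_at X 1\<^esub> f = tmap f \<cdot>\<^bsub>cat_at X 1\<^esub> h1" for h1 h2 f
  define glue where "glue F \<theta> \<longleftrightarrow> \<theta> \<in> Hom (cat_at X 2) (omap (pull X p1) F) (omap (pull X p2) F) \<and>
      iso_arr (cat_at X 2) \<theta> \<and>
      pull_along X p23 p1 p2 F \<theta> \<cdot>\<^bsub>cat_at X 3\<^esub> pull_along X p12 p1 p2 F \<theta> =
      pull_along X p13 p1 p2 F \<theta>" for F \<theta>
  define glmor where "glmor \<theta>1 \<theta>2 f \<longleftrightarrow>
      amap (pull X p2) f \<cdot>\<^bsub>cat_at X 2\<^esub> \<theta>1 = \<theta>2 \<cdot>\<^bsub>cat_at X 2\<^esub> amap (pull X p1) f" for \<theta>1 \<theta>2 f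
  let ?g = "gluing 2 p1 p2"
  note bij = gluing_bij[OF p bc1]
  \<comment> \<open>From gluing data, coassociativity has to come first, because the proof of the
    counit law uses it. From a comodule, all conditions follow from the gluing calculus at two and
    three points.\<close>
  have glue_iff: "glue F (?g F h) \<longleftrightarrow> coact F h"
    if F: "F \<in> Obj (cat_at X 1)" and h: "h \<in> Hom (cat_at X 1) F (tobj F)" for F h
  proof
    note pa = pull_along_gluing[OF p v(1) h F] pull_along_gluing[OF p v(2) h F]
      pull_along_gluing[OF p v(3) h F]
    show "coact F h" if g: "glue F (?g F h)"
    proof -
      have co: "tmap h \<cdot>\<^bsub>cat_at X 1\<^esub> h = amap (pull X e) (unit (R e) (omap (rfun (R e)) F)) \<cdot>\<^bsub>cat_at X 1\<^esub> h"
        using g by (intro gluing_cocycle_imp_coassoc[OF p bc1 sq bc2 F h]) (simp add: glue_def pa comps)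
      show ?thesis
        using gluing_iso_imp_counit[OF p s sp F h _ co] g h co by (simp add: coact_def glue_def)
    qed
    show "glue F (?g F h)" if c: "coact F h"
      using c gluing_hom[OF p h F] gluing_iso[OF p h F] gluing_comp[OF q h F]
      by (simp add: coact_def glue_def pa comps)
  qed
  \<comment> \<open>The bijection between all arrows \<open>h\<close> and all arrows
    \<open>\<theta>\<close> is restricted to the admissible ones, which \<open>glue_iff\<close>
    matches.\<close>
  have "bij_betw (?g F) {h. coact F h} {\<theta>. glue F \<theta>}" if F: "F \<in> Obj (cat_at X 1)" for F
  proof (rule bij_betw_subset[OF bij[OF F F]])
    show "{h. coact F h} \<subseteq> Hom (cat_at X 1) F (tobj F)"
      by (auto simp: coact_def)
    show "?g F ` {h. coact F h} = {\<theta>. glue F \<theta>}"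
    proof (intro equalityI subsetI)
      fix \<theta> assume \<theta>: "\<theta> \<in> {\<theta>. glue F \<theta>}"
      then obtain h where "h \<in> Hom (cat_at X 1) F (tobj F)" "\<theta> = ?g F h"
        using bij_betw_imp_surj_on[OF bij[OF F F]] by (auto simp: glue_def)
      then show "\<theta> \<in> ?g F ` {h. coact F h}"
        using glue_iff[OF F] \<theta> by auto
    qed (use glue_iff[OF F] in \<open>auto simp: coact_def\<close>)
  qed
  \<comment> \<open>Both sides of the condition on \<open>f\<close> are gluing maps, of
    \<open>tmap f\<close> after \<open>h\<close> and of \<open>k\<close> after \<open>f\<close>.
    Gluing is injective on all arrows from \<open>F\<close> to \<open>tobj G\<close>, so it can be
    removed.\<close>
  moreover have "glmor (?g F h) (?g G k) f \<longleftrightarrow> comor h k f"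
    if FG: "F \<in> Obj (cat_at X 1)" "G \<in> Obj (cat_at X 1)" and hk: "coact F h" "coact G k"
      and f: "f \<in> Hom (cat_at X 1) F G" for F G h k f
  proof -
    have h: "h \<in> Hom (cat_at X 1) F (tobj F)" and k: "k \<in> Hom (cat_at X 1) G (tobj G)"
      using hk by (auto simp: coact_def)
    have "glmor (?g F h) (?g G k) f \<longleftrightarrow>
        ?g G (tmap f \<cdot>\<^bsub>cat_at X 1\<^esub> h) = ?g G (k \<cdot>\<^bsub>cat_at X 1\<^esub> f)"
      using gluing_comp_left[OF p h f] gluing_comp_right[OF p k f FG(2)] by (simp add: glmor_def)
    also have "\<dots> \<longleftrightarrow> tmap f \<cdot>\<^bsub>cat_at X 1\<^esub> h = k \<cdot>\<^bsub>cat_at X 1\<^esub> f"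
      by (rule inj_on_eq_iff[OF bij_betw_imp_inj_on[OF bij[OF FG]]])
        (use h k f in \<open>auto simp: Hom_def\<close>)
    finally show ?thesis by (auto simp: comor_def)
  qed
  moreover have "comor h h (Ident (cat_at X 1) F)" if "F \<in> Obj (cat_at X 1)" "coact F h" for F h
    using that by (auto simp: comor_def coact_def Hom_def)
  moreover have "comor h l (g \<cdot>\<^bsub>cat_at X 1\<^esub> f)"
    if co: "coact F h" "coact G k" "coact H l" and fg: "f \<in> Hom (cat_at X 1) F G" "g \<in> Hom (cat_at X 1) G H"
      and c: "comor h k f" "comor k l g" for F G H h k l f g
  proof -
    have a: "f \<in> Arr (cat_at X 1)" "Dom (cat_at X 1) f = F" "Cod (cat_at X 1) f = G"
      "g \<in> Arr (cat_at X 1)" "Dom (cat_at X 1) g = G" "Cod (cat_at X 1) g = H"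
      "h \<in> Arr (cat_at X 1)" "Dom (cat_at X 1) h = F" "Cod (cat_at X 1) h = tobj F"
      "k \<in> Arr (cat_at X 1)" "Dom (cat_at X 1) k = G" "Cod (cat_at X 1) k = tobj G"
      "l \<in> Arr (cat_at X 1)" "Dom (cat_at X 1) l = H" "Cod (cat_at X 1) l = tobj H"
      using co fg by (auto simp: coact_def Hom_def)
    show ?thesis
      using C1.comp_eq_extend[OF c(2)[unfolded comor_def], of f] c(1)
      by (simp add: comor_def a)
  qed
  ultimately have "equivalent_categories (struct_cat (cat_at X 1) glue glmor) (struct_cat (cat_at X 1) coact comor)"
    by (intro equivalent_struct_cats[OF category_at])
  moreover have "Kern X = struct_cat (cat_at X 1) glue glmor"
    by (simp add: Kern_def Let_def glue_def[abs_def] glmor_def[abs_def] p_defs)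
  moreover have "comonad_descent X R = struct_cat (cat_at X 1) coact comor"
    by (simp add: comonad_descent_def comodule_cat_def Let_def coact_def[abs_def] comor_def[abs_def])
  ultimately show ?thesis
    by (simp add: Kern_Sk0)
qed

end
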